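(* Let $L$ be a finite semimodular lattice and let $K$ be a stripped sublattice of $L$. If $K$ satisfies the Swing Lemma, then $L$ satisfies the General Swing Lemma.
   Context: Semimodular means upper semimodular. A prime interval $\mathfrak{p}=[0_{\mathfrak p},1_{\mathfrak p}]$ is an interval with $0_{\mathfrak p}$ covered by $1_{\mathfrak p}$. For a lattice $M$, $\mathrm{con}_M(\mathfrak{p})$ is the least congruence of $M$ collapsing $0_{\mathfrak p}$ and $1_{\mathfrak p}$; $\mathfrak p$ congruence spreads to $\mathfrak q$ in $M$ (equivalently, $\mathfrak q$ is collapsed by $\mathrm{con}_M(\mathfrak p)$) if $\mathrm{con}_M(\mathfrak p)\ge\mathrm{con}_M(\mathfrak q)$. Stripping: a covering multi-diamond in a lattice $M$ is an interval of $M$ isomorphic to $\mathsf{M}_n$ (the $(n+2)$-element modular lattice of length 2 with $n$ atoms) for some $n\ge3$. An element $m\in M$ is a tab of $M$ if it is doubly-irreducible (exactly one lower cover and exactly one upper cover) and lies in a covering multi-diamond of $M$. Then $M\setminus\{m\}$ is a sublattice of $M$, obtained from $M$ by stripping the tab $m$. A finite lattice is stripped if it has no tabs. A stripped sublattice of a finite lattice $L$ (in the sense of the claim) is a sublattice without tabs obtained from $L$ by consecutively stripping tabs (at each step a tab of the current lattice). Perspectivity: an interval $I=[0_I,1_I]$ is down perspective to $J=[0_J,1_J]$ if $0_I\vee 1_J=1_I$ and $0_I\wedge 1_J=0_J$; in that case $J$ is up perspective to $I$. $\mathsf{S}_7$ is the 7-element lattice with elements $u,y,o,x,a,m,i$ whose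 covering relations are $u\prec y$, $u\prec o$, $y\prec x$, $y\prec a$, $o\prec a$, $o\prec m$, $x\prec i$, $a\prec i$, $m\prec i$. Of its three dual atoms $x,a,m$, exactly one, $a=y\vee o$, is a proper join (i.e. join-reducible). Swing: for prime intervals $\mathfrak p,\mathfrak q$ in a lattice $M$, $\mathfrak p$ swings to $\mathfrak q$ if (i) $\mathfrak p\ne\mathfrak q$; (ii) $1_{\mathfrak p}=1_{\mathfrak q}$; (iii) there is a lower cover $c\neq 0_{\mathfrak p},0_{\mathfrak q}$ of $1_{\mathfrak p}$ such that $\{0_{\mathfrak p},0_{\mathfrak q},c\}$ generates a sublattice $S$ of $M$ isomorphic to $\mathsf{S}_7$, where $0_{\mathfrak q}$ is the unique dual atom of $S$ that is a proper join (in $S$). SPS projective: $\mathfrak p$ is SPS projective to $\mathfrak q$ in $M$ if either $\mathfrak p=\mathfrak q$ or there exist a prime interval $\mathfrak r$ with $\mathfrak p$ up perspective to $\mathfrak r$ and a finite sequence of prime intervals $\mathfrak r=\mathfrak r_0,\mathfrak r_1,\dots,\mathfrak r_n=\mathfrak q$ of $M$ such that, for each $k$ with $0\le k<n$, either $\mathfrak r_k$ is down perspective to $\mathfrak r_{k+1}$ or $\mathfrak r_k$ swings to $\mathfrak r_{k+1}$. Switch: for distinct prime intervals $\mathfrak p,\mathfrak q$ in $M$, $\mathfrak p$ switches to $\mathfrak q$ if both lie in a common covering $\mathsf{M}_3$ in $M$, i.e. in a common sublattice of $M$ isomorphic to $\mathsf{M}_3$ whose covering relations are covering relations of $M$. A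 lattice $M$ satisfies the Swing Lemma if for all prime intervals $\mathfrak p,\mathfrak q$ of $M$: $\mathfrak p$ congruence spreads to $\mathfrak q$ if and only if $\mathfrak p$ is SPS projective to $\mathfrak q$. A lattice $M$ satisfies the General Swing Lemma if for all distinct prime intervals $\mathfrak p,\mathfrak q$ of $M$: $\mathfrak q$ is collapsed by $\mathrm{con}_M(\mathfrak p)$ if and only if there exist an integer $n\ge0$ and sequences of prime intervals of $M$, $\mathfrak{p}_0 = \mathfrak{p}, \mathfrak{p}_1, \dots, \mathfrak{p}_n$ and $\mathfrak{q}_0, \mathfrak{q}_1, \dots, \mathfrak{q}_n = \mathfrak{q}$, where $\mathfrak{p}_k$ is SPS projective to $\mathfrak{q}_k$ for $k = 0,\dots, n$, and, provided that $n > 0$, $\mathfrak{q}_k$ switches to $\mathfrak{p}_{k+1}$ for $k=0,\dots, n-1$. *)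

theory Defs
  imports Main
begin

text \<open>
  A lattice is represented by a nonempty subset of a type of class \<open>lattice\<close> that is closed under
  \<open>sup\<close> and \<open>inf\<close>; \<open>UNIV\<close> is the case where the type itself is the lattice. All notions
  are relative to such a carrier, because stripping changes the carrier.
\<close>

definition sublattice :: "'a::lattice set \<Rightarrow> 'a set \<Rightarrow> bool" where
  "sublattice S M \<longleftrightarrow>
     S \<noteq> {} \<and> S \<subseteq> M \<and> (\<forall>x\<in>S. \<forall>y\<in>S. sup x y \<in> S \<and> inf x y \<in> S)"

definition generated_sublattice :: "'a::lattice set \<Rightarrow> 'a set \<Rightarrow> 'a set" where
  "generated_sublattice M X = \<Inter>{S. sublattice S M \<and> X \<subseteq> S}"

definition lattice_isomorphic :: "'a::lattice set \<Rightarrow> 'b::lattice set \<Rightarrow> bool" where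
  "lattice_isomorphic A B \<longleftrightarrow>
     (\<exists>f. bij_betw f A B \<and>
          (\<forall>x\<in>A. \<forall>y\<in>A. f (sup x y) = sup (f x) (f y) \<and> f (inf x y) = inf (f x) (f y)))"

definition covered_by :: "'a::lattice set \<Rightarrow> 'a \<Rightarrow> 'a \<Rightarrow> bool" where
  "covered_by M x y \<longleftrightarrow> x \<in> M \<and> y \<in> M \<and> x < y \<and> \<not> (\<exists>z\<in>M. x < z \<and> z < y)"

definition semimodular :: "'a::lattice set \<Rightarrow> bool" where
  "semimodular M \<longleftrightarrow>
     (\<forall>x\<in>M. \<forall>y\<in>M. \<forall>z\<in>M. covered_by M x y \<longrightarrow>
        sup x z = sup y z \<or> covered_by M (sup x z) (sup y z))"

definition interval :: "'a::lattice set \<Rightarrow> 'a \<Rightarrow> 'a \<Rightarrow> 'a set" where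
  "interval M x y = {z \<in> M. x \<le> z \<and> z \<le> y}"

text \<open>The type below has infinitely many atoms; \<open>Mn n\<close> is its sublattice on the first \<open>n\<close> of them.\<close>

datatype mn = Mn_bot | Mn_atom nat | Mn_top

instantiation mn :: lattice
begin

definition less_eq_mn :: "mn \<Rightarrow> mn \<Rightarrow> bool" where
  "(p::mn) \<le> q \<longleftrightarrow> p = q \<or> p = Mn_bot \<or> q = Mn_top"

definition less_mn :: "mn \<Rightarrow> mn \<Rightarrow> bool" where
  "(p::mn) < q \<longleftrightarrow> p \<le> q \<and> p \<noteq> q"

definition sup_mn :: "mn \<Rightarrow> mn \<Rightarrow> mn" where
  "sup p q = (if p \<le> q then q else if q \<le> p then p else Mn_top)"

definition inf_mn :: "mn \<Rightarrow> mn \<Rightarrow> mn" where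
  "inf p q = (if p \<le> q then p else if q \<le> p then q else Mn_bot)"

instance
  by standard (auto simp: less_eq_mn_def less_mn_def sup_mn_def inf_mn_def)

end

definition Mn :: "nat \<Rightarrow> mn set" where
  "Mn n = {Mn_bot, Mn_top} \<union> Mn_atom ` {..<n}"

datatype s7 = S7_u | S7_y | S7_o | S7_x | S7_a | S7_m | S7_i

instantiation s7 :: lattice
begin

definition less_eq_s7 :: "s7 \<Rightarrow> s7 \<Rightarrow> bool" where
  "(p::s7) \<le> q \<longleftrightarrow> p = q \<or> p = S7_u \<or> q = S7_i \<or>
     (p, q) \<in> {(S7_y, S7_x), (S7_y, S7_a), (S7_o, S7_a), (S7_o, S7_m)}"

definition less_s7 :: "s7 \<Rightarrow> s7 \<Rightarrow> bool" where
  "(p::s7) < q \<longleftrightarrow> p \<le> q \<and> p \<noteq> q"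

definition sup_s7 :: "s7 \<Rightarrow> s7 \<Rightarrow> s7" where
  "sup p q = (if p \<le> q then q else if q \<le> p then p
              else if {p, q} = {S7_y, S7_o} then S7_a else S7_i)"

definition inf_s7 :: "s7 \<Rightarrow> s7 \<Rightarrow> s7" where
  "inf p q = (if p \<le> q then p else if q \<le> p then q
              else if {p, q} = {S7_x, S7_a} then S7_y
              else if {p, q} = {S7_a, S7_m} then S7_o else S7_u)"

instance
proof
  fix p q r :: s7
  show "p < q \<longleftrightarrow> p \<le> q \<and> \<not> q \<le> p"
    by (cases p; cases q; simp add: less_eq_s7_def less_s7_def)
  show "p \<le> p"
    by (simp add: less_eq_s7_def)
  show "p \<le> q \<Longrightarrow> q \<le> r \<Longrightarrow> p \<le> r"
    by (cases p; cases q; cases r; simp add: less_eq_s7_def)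
  show "p \<le> q \<Longrightarrow> q \<le> p \<Longrightarrow> p = q"
    by (cases p; cases q; simp add: less_eq_s7_def)
  show "inf p q \<le> p" "inf p q \<le> q" "p \<le> sup p q" "q \<le> sup p q"
    by (cases p; cases q; simp add: less_eq_s7_def inf_s7_def sup_s7_def doubleton_eq_iff)+
  show "p \<le> q \<Longrightarrow> p \<le> r \<Longrightarrow> p \<le> inf q r"
    by (cases p; cases q; cases r; simp add: less_eq_s7_def inf_s7_def doubleton_eq_iff)
  show "q \<le> p \<Longrightarrow> r \<le> p \<Longrightarrow> sup q r \<le> p"
    by (cases p; cases q; cases r; simp add: less_eq_s7_def sup_s7_def doubleton_eq_iff)
qed

end

lemma s7_bex_UNIV:
  "(\<exists>z\<in>UNIV. P z) \<longleftrightarrow> P S7_u \<or> P S7_y \<or> P S7_o \<or> P S7_x \<or> P S7_a \<or> P S7_m \<or> P S7_i"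
  by (metis UNIV_I s7.exhaust)

lemma covered_by_s7_iff:
  "covered_by UNIV p q \<longleftrightarrow>
     (p, q) \<in> {(S7_u, S7_y), (S7_u, S7_o), (S7_y, S7_x), (S7_y, S7_a), (S7_o, S7_a),
               (S7_o, S7_m), (S7_x, S7_i), (S7_a, S7_i), (S7_m, S7_i)}"
  unfolding covered_by_def s7_bex_UNIV
  by (cases p; cases q; simp add: less_eq_s7_def less_s7_def)

definition lattice_congruence :: "'a::lattice set \<Rightarrow> ('a \<times> 'a) set \<Rightarrow> bool" where
  "lattice_congruence M \<theta> \<longleftrightarrow> equiv M \<theta> \<and>
     (\<forall>x y x' y'. (x, y) \<in> \<theta> \<and> (x', y') \<in> \<theta> \<longrightarrow>
        (sup x x', sup y y') \<in> \<theta> \<and> (inf x x', inf y y') \<in> \<theta>)"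

text \<open>An interval \<open>p\<close> is represented by the pair of its endpoints
  \<open>(0\<^sub>p, 1\<^sub>p) = (fst p, snd p)\<close>.\<close>

definition prime_interval :: "'a::lattice set \<Rightarrow> 'a \<times> 'a \<Rightarrow> bool" where
  "prime_interval M p \<longleftrightarrow> covered_by M (fst p) (snd p)"

definition con :: "'a::lattice set \<Rightarrow> 'a \<times> 'a \<Rightarrow> ('a \<times> 'a) set" where
  "con M p = \<Inter>{\<theta>. lattice_congruence M \<theta> \<and> p \<in> \<theta>}"

lemma con_least:
  assumes "lattice_congruence M \<theta>" "p \<in> \<theta>"
  shows "con M p \<subseteq> \<theta>"
  using assms unfolding con_def by blast

lemma lattice_congruence_con:
  assumes M: "sublattice M UNIV" and p: "fst p \<in> M" "snd p \<in> M"
  shows "lattice_congruence M (con M p)" and "p \<in> con M p"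
proof -
  let ?C = "{\<theta>. lattice_congruence M \<theta> \<and> p \<in> \<theta>}"
  have full: "M \<times> M \<in> ?C"
    using M p
    by (auto simp: lattice_congruence_def sublattice_def equiv_def refl_on_def sym_def trans_def
        mem_Times_iff)
  have "equiv M (\<Inter>?C)"
  proof (rule equivI)
    show "\<Inter>?C \<subseteq> M \<times> M"
      using full by blast
    show "refl_on M (\<Inter>?C)"
      by (auto simp: lattice_congruence_def equiv_def refl_on_def)
    show "sym (\<Inter>?C)"
      unfolding sym_def by (auto simp: lattice_congruence_def equiv_def dest: symD)
    show "trans (\<Inter>?C)"
      unfolding trans_def by (auto simp: lattice_congruence_def equiv_def dest: transD)
  qed
  then show "lattice_congruence M (con M p)"
    unfolding lattice_congruence_def con_def by auto
  show "p \<in> con M p"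
    unfolding con_def by blast
qed

definition congruence_spreads :: "'a::lattice set \<Rightarrow> 'a \<times> 'a \<Rightarrow> 'a \<times> 'a \<Rightarrow> bool" where
  "congruence_spreads M p q \<longleftrightarrow> con M q \<subseteq> con M p"

definition covering_multi_diamond :: "'a::lattice set \<Rightarrow> 'a set \<Rightarrow> bool" where
  "covering_multi_diamond M D \<longleftrightarrow>
     (\<exists>x\<in>M. \<exists>y\<in>M. x \<le> y \<and> D = interval M x y) \<and> (\<exists>n\<ge>3. lattice_isomorphic D (Mn n))"

definition doubly_irreducible :: "'a::lattice set \<Rightarrow> 'a \<Rightarrow> bool" where
  "doubly_irreducible M m \<longleftrightarrow>
     m \<in> M \<and> (\<exists>!x. covered_by M x m) \<and> (\<exists>!y. covered_by M m y)"

definition tab :: "'a::lattice set \<Rightarrow> 'a \<Rightarrow> bool" where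
  "tab M m \<longleftrightarrow> doubly_irreducible M m \<and> (\<exists>D. covering_multi_diamond M D \<and> m \<in> D)"

definition strips_to :: "'a::lattice set \<Rightarrow> 'a set \<Rightarrow> bool" where
  "strips_to M N \<longleftrightarrow> (\<exists>m. tab M m \<and> N = M - {m})"

definition stripped :: "'a::lattice set \<Rightarrow> bool" where
  "stripped M \<longleftrightarrow> \<not> (\<exists>m. tab M m)"

definition stripped_sublattice :: "'a::lattice set \<Rightarrow> 'a set \<Rightarrow> bool" where
  "stripped_sublattice K L \<longleftrightarrow> sublattice K L \<and> strips_to\<^sup>*\<^sup>* L K \<and> stripped K"

definition down_perspective :: "'a::lattice \<times> 'a \<Rightarrow> 'a \<times> 'a \<Rightarrow> bool" where
  "down_perspective I J \<longleftrightarrow> sup (fst I) (snd J) = snd I \<and> inf (fst I) (snd J) = fst J"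

definition up_perspective :: "'a::lattice \<times> 'a \<Rightarrow> 'a \<times> 'a \<Rightarrow> bool" where
  "up_perspective J I \<longleftrightarrow> down_perspective I J"

definition dual_atom :: "'a::lattice set \<Rightarrow> 'a \<Rightarrow> bool" where
  "dual_atom S d \<longleftrightarrow> (\<exists>t. (\<forall>x\<in>S. x \<le> t) \<and> covered_by S d t)"

definition proper_join :: "'a::lattice set \<Rightarrow> 'a \<Rightarrow> bool" where
  "proper_join S d \<longleftrightarrow> (\<exists>x\<in>S. \<exists>y\<in>S. x \<noteq> d \<and> y \<noteq> d \<and> d = sup x y)"

definition swings :: "'a::lattice set \<Rightarrow> 'a \<times> 'a \<Rightarrow> 'a \<times> 'a \<Rightarrow> bool" where
  "swings M p q \<longleftrightarrow>
     prime_interval M p \<and> prime_interval M q \<and> p \<noteq> q \<and> snd p = snd q \<and>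
     (\<exists>c S. covered_by M c (snd p) \<and> c \<noteq> fst p \<and> c \<noteq> fst q \<and>
        S = generated_sublattice M {fst p, fst q, c} \<and>
        lattice_isomorphic S (UNIV :: s7 set) \<and>
        (\<forall>d. dual_atom S d \<and> proper_join S d \<longleftrightarrow> d = fst q))"

definition sps_step :: "'a::lattice set \<Rightarrow> 'a \<times> 'a \<Rightarrow> 'a \<times> 'a \<Rightarrow> bool" where
  "sps_step M r s \<longleftrightarrow>
     prime_interval M r \<and> prime_interval M s \<and> (down_perspective r s \<or> swings M r s)"

definition sps_projective :: "'a::lattice set \<Rightarrow> 'a \<times> 'a \<Rightarrow> 'a \<times> 'a \<Rightarrow> bool" where
  "sps_projective M p q \<longleftrightarrow>
     p = q \<or> (\<exists>r. prime_interval M r \<and> up_perspective p r \<and> (sps_step M)\<^sup>*\<^sup>* r q)"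

definition covering_M3 :: "'a::lattice set \<Rightarrow> 'a set \<Rightarrow> bool" where
  "covering_M3 M S \<longleftrightarrow>
     sublattice S M \<and> lattice_isomorphic S (Mn 3) \<and>
     (\<forall>x y. covered_by S x y \<longrightarrow> covered_by M x y)"

definition switches :: "'a::lattice set \<Rightarrow> 'a \<times> 'a \<Rightarrow> 'a \<times> 'a \<Rightarrow> bool" where
  "switches M p q \<longleftrightarrow>
     prime_interval M p \<and> prime_interval M q \<and> p \<noteq> q \<and>
     (\<exists>S. covering_M3 M S \<and> {fst p, snd p, fst q, snd q} \<subseteq> S)"

definition satisfies_swing_lemma :: "'a::lattice set \<Rightarrow> bool" where
  "satisfies_swing_lemma M \<longleftrightarrow>
     (\<forall>p q. prime_interval M p \<and> prime_interval M q \<longrightarrow>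
        (congruence_spreads M p q \<longleftrightarrow> sps_projective M p q))"

definition satisfies_general_swing_lemma :: "'a::lattice set \<Rightarrow> bool" where
  "satisfies_general_swing_lemma M \<longleftrightarrow>
     (\<forall>p q. prime_interval M p \<and> prime_interval M q \<and> p \<noteq> q \<longrightarrow>
        (q \<in> con M p \<longleftrightarrow>
          (\<exists>(n::nat) P Q.
             (\<forall>k\<le>n. prime_interval M (P k) \<and> prime_interval M (Q k)) \<and>
             P 0 = p \<and> Q n = q \<and>
             (\<forall>k\<le>n. sps_projective M (P k) (Q k)) \<and>
             (\<forall>k<n. switches M (Q k) (P (Suc k))))))"

end

theory Submission
  imports Defs
begin

text \<open>
  Undo the strippings one tab at a time. Let \<open>m\<close> be a tab of \<open>M\<close> inside a covering multi-diamond
  \<open>[b, t]\<close>, let \<open>N = M - {m}\<close>, and let \<open>p\<close> be a prime interval of \<open>N\<close> with congruence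
  \<open>\<alpha> = con N p\<close>. If \<open>\<alpha> \<union> {(m, m)}\<close> is a congruence of \<open>M\<close>, then \<open>p\<close> collapses in \<open>N\<close> every
  prime interval of \<open>N\<close> that it collapses in \<open>M\<close>. By semimodularity this can fail for only two reasons.
  Either \<open>\<alpha>\<close> collapses some prime interval of \<open>[b, t]\<close>, or it collapses some \<open>[z, t]\<close> with
  \<open>z \<squnion> b = t\<close>, \<open>z < t\<close>; in the second case \<open>z\<close> may be taken to be a lower cover of \<open>t\<close>, and in \<open>M\<close> the interval
  \<open>[z, t]\<close> swings to \<open>[x, t]\<close> for every atom \<open>x \<noteq> m\<close> of the diamond, with \<open>m\<close> as the third dual atom.
  In both cases \<open>p\<close> reaches the diamond, switches move freely inside it, and
  \<open>con M p\<close> restricted to \<open>N\<close> lies in the join of \<open>\<alpha>\<close> with congruences generated by prime intervals of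
  the diamond. A prime interval collapsed by a join of congruences is collapsed by one of them.
\<close>

section \<open>Congruences and covers\<close>

lemma sublatticeD:
  assumes "sublattice S M" "x \<in> S" "y \<in> S"
  shows "sup x y \<in> S" "inf x y \<in> S" "x \<in> M"
  using assms unfolding sublattice_def by auto

lemma covered_byD:
  assumes "covered_by M x y"
  shows "x \<in> M" "y \<in> M" "x < y" "z \<in> M \<Longrightarrow> x \<le> z \<Longrightarrow> z \<le> y \<Longrightarrow> z = x \<or> z = y"
  using assms unfolding covered_by_def by (auto simp: less_le)

lemma prime_intervalD:
  assumes "prime_interval M p"
  shows "fst p \<in> M" "snd p \<in> M" "fst p < snd p"
  using assms covered_byD unfolding prime_interval_def by auto

lemma lattice_congruenceD:
  assumes "lattice_congruence M \<theta>"
  shows "(x, y) \<in> \<theta> \<Longrightarrow> x \<in> M" "(x, y) \<in> \<theta> \<Longrightarrow> y \<in> M" "x \<in> M \<Longrightarrow> (x, x) \<in> \<theta>"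
    "(x, y) \<in> \<theta> \<Longrightarrow> (y, x) \<in> \<theta>" "(x, y) \<in> \<theta> \<Longrightarrow> (y, z) \<in> \<theta> \<Longrightarrow> (x, z) \<in> \<theta>"
    "(x, y) \<in> \<theta> \<Longrightarrow> z \<in> M \<Longrightarrow> (sup x z, sup y z) \<in> \<theta>"
    "(x, y) \<in> \<theta> \<Longrightarrow> z \<in> M \<Longrightarrow> (inf x z, inf y z) \<in> \<theta>"
    "(x, y) \<in> \<theta> \<Longrightarrow> z \<in> M \<Longrightarrow> (sup z x, sup z y) \<in> \<theta>"
    "(x, y) \<in> \<theta> \<Longrightarrow> z \<in> M \<Longrightarrow> (inf z x, inf z y) \<in> \<theta>"
proof -
  have e: "equiv M \<theta>"
    using assms unfolding lattice_congruence_def by (rule conjunct1)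
  have c: "(sup x x', sup y y') \<in> \<theta> \<and> (inf x x', inf y y') \<in> \<theta>"
    if "(x, y) \<in> \<theta>" "(x', y') \<in> \<theta>" for x y x' y'
    using assms that unfolding lattice_congruence_def by blast
  show "(x, y) \<in> \<theta> \<Longrightarrow> x \<in> M" "(x, y) \<in> \<theta> \<Longrightarrow> y \<in> M"
    using equiv_type[OF e] by auto
  show r: "z \<in> M \<Longrightarrow> (z, z) \<in> \<theta>" for z
    using e by (simp add: equiv_def refl_on_def)
  show "(x, y) \<in> \<theta> \<Longrightarrow> (y, x) \<in> \<theta>"
    using e by (auto simp: equiv_def dest: symD)
  show "(x, y) \<in> \<theta> \<Longrightarrow> (y, z) \<in> \<theta> \<Longrightarrow> (x, z) \<in> \<theta>"
    using e by (auto simp: equiv_def dest: transD)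
  show "(sup x z, sup y z) \<in> \<theta>" "(inf x z, inf y z) \<in> \<theta>" "(sup z x, sup z y) \<in> \<theta>"
    "(inf z x, inf z y) \<in> \<theta>" if "(x, y) \<in> \<theta>" "z \<in> M"
    using c[OF that(1) r[OF that(2)]] c[OF r[OF that(2)] that(1)] by simp_all
qed

text \<open>Compatibility with one varying argument suffices: two arguments are changed one after
  the other, and transitivity joins the two steps.\<close>

lemma lattice_congruenceI:
  assumes "\<theta> \<subseteq> M \<times> M" "\<And>x. x \<in> M \<Longrightarrow> (x, x) \<in> \<theta>"
    and "\<And>x y. (x, y) \<in> \<theta> \<Longrightarrow> (y, x) \<in> \<theta>"
    and tr: "\<And>x y z. (x, y) \<in> \<theta> \<Longrightarrow> (y, z) \<in> \<theta> \<Longrightarrow> (x, z) \<in> \<theta>"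
    and s: "\<And>x y z. (x, y) \<in> \<theta> \<Longrightarrow> z \<in> M \<Longrightarrow> (sup x z, sup y z) \<in> \<theta>"
    and i: "\<And>x y z. (x, y) \<in> \<theta> \<Longrightarrow> z \<in> M \<Longrightarrow> (inf x z, inf y z) \<in> \<theta>"
  shows "lattice_congruence M \<theta>"
proof -
  have "equiv M \<theta>"
  proof (rule equivI)
    show "refl_on M \<theta>" using assms(2) by (simp add: refl_on_def)
    show "sym \<theta>" using assms(3) by (rule symI)
    show "trans \<theta>" using tr by (rule transI)
  qed (fact assms(1))
  moreover have "(sup x x', sup y y') \<in> \<theta> \<and> (inf x x', inf y y') \<in> \<theta>"
    if "(x, y) \<in> \<theta>" "(x', y') \<in> \<theta>" for x y x' y'
  proof
    have m: "x' \<in> M" "y \<in> M" using subsetD[OF assms(1)] that by auto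
    show "(sup x x', sup y y') \<in> \<theta>"
      using tr[OF s[OF that(1) m(1)]] s[OF that(2) m(2)] by (simp add: sup_commute)
    show "(inf x x', inf y y') \<in> \<theta>"
      using tr[OF i[OF that(1) m(1)]] i[OF that(2) m(2)] by (simp add: inf_commute)
  qed
  ultimately show ?thesis unfolding lattice_congruence_def by blast
qed

text \<open>The transitive closure is the join of the congruences in \<open>\<Theta>\<close>:
  joining or meeting with a fixed element maps a path of collapsed pairs to such a path. A member of
  \<open>\<Theta>\<close> supplies reflexivity.\<close>

lemma lattice_congruence_trancl_Union:
  assumes "\<Theta> \<noteq> {}" and cong: "\<And>\<theta>. \<theta> \<in> \<Theta> \<Longrightarrow> lattice_congruence M \<theta>"
  shows "lattice_congruence M ((\<Union>\<Theta>)\<^sup>+)"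
proof (rule lattice_congruenceI)
  show "(\<Union>\<Theta>)\<^sup>+ \<subseteq> M \<times> M"
  proof (intro trancl_subset_Sigma subrelI)
    fix x y assume "(x, y) \<in> \<Union>\<Theta>"
    then obtain \<theta> where "\<theta> \<in> \<Theta>" "(x, y) \<in> \<theta>" by blast
    then show "(x, y) \<in> M \<times> M" using lattice_congruenceD(1,2)[OF cong] by simp
  qed
  show "(x, x) \<in> (\<Union>\<Theta>)\<^sup>+" if "x \<in> M" for x
    using assms(1) lattice_congruenceD(3)[OF cong that] by blast
  have "sym (\<Union>\<Theta>)"
  proof (rule symI)
    fix x y assume "(x, y) \<in> \<Union>\<Theta>"
    then obtain \<theta> where "\<theta> \<in> \<Theta>" "(x, y) \<in> \<theta>" by blast
    then show "(y, x) \<in> \<Union>\<Theta>" using lattice_congruenceD(4)[OF cong] by blast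
  qed
  then show "(y, x) \<in> (\<Union>\<Theta>)\<^sup>+" if "(x, y) \<in> (\<Union>\<Theta>)\<^sup>+" for x y
    using that by (meson sym_trancl symD)
  show "(x, z) \<in> (\<Union>\<Theta>)\<^sup>+" if "(x, y) \<in> (\<Union>\<Theta>)\<^sup>+" "(y, z) \<in> (\<Union>\<Theta>)\<^sup>+" for x y z
    using that by (rule trancl_trans)
  fix x y z assume xy: "(x, y) \<in> (\<Union>\<Theta>)\<^sup>+" and z: "z \<in> M"
  show "(sup x z, sup y z) \<in> (\<Union>\<Theta>)\<^sup>+"
    using xy
  proof induction
    case (base y)
    then show ?case using lattice_congruenceD(6)[OF cong _ z] by blast
  next
    case (step y w)
    then have "(sup y z, sup w z) \<in> \<Union>\<Theta>" using lattice_congruenceD(6)[OF cong _ z] by blast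
    with step.IH show ?case by (rule trancl_into_trancl)
  qed
  show "(inf x z, inf y z) \<in> (\<Union>\<Theta>)\<^sup>+"
    using xy
  proof induction
    case (base y)
    then show ?case using lattice_congruenceD(7)[OF cong _ z] by blast
  next
    case (step y w)
    then have "(inf y z, inf w z) \<in> \<Union>\<Theta>" using lattice_congruenceD(7)[OF cong _ z] by blast
    with step.IH show ?case by (rule trancl_into_trancl)
  qed
qed

text \<open>The polynomial \<open>z \<mapsto> (z \<squnion> u) \<sqinter> v\<close> maps a path from \<open>u\<close> to \<open>v\<close> into \<open>{u, v}\<close>, so one step
  of the path is mapped onto \<open>(u, v)\<close>.\<close>

lemma covered_by_in_trancl_Union:
  assumes M: "sublattice M UNIV" and cong: "\<And>\<theta>. \<theta> \<in> \<Theta> \<Longrightarrow> lattice_congruence M \<theta>"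
    and uv: "covered_by M u v" "(u, v) \<in> (\<Union>\<Theta>)\<^sup>+"
  shows "(u, v) \<in> \<Union>\<Theta>"
proof -
  note d = covered_byD[OF uv(1)]
  let ?h = "\<lambda>z. inf (sup z u) v"
  have h: "?h z = u \<or> ?h z = v" if "z \<in> M" for z
    using d that M by (intro d(4)) (auto simp: sublatticeD le_infI1 less_imp_le)
  have step: "(?h y, ?h z) \<in> \<Union>\<Theta>" if yz: "(y, z) \<in> \<Union>\<Theta>" for y z
    using yz d(1,2) lattice_congruenceD(6,7)[OF cong] by blast
  have mem: "y \<in> M \<and> z \<in> M" if yz: "(y, z) \<in> \<Union>\<Theta>" for y z
    using yz lattice_congruenceD(1,2)[OF cong] by blast
  have hu: "?h u = u" using d(3) by (simp add: inf_absorb1 less_imp_le)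
  have "?h z = u \<or> (u, v) \<in> \<Union>\<Theta>" if "(u, z) \<in> (\<Union>\<Theta>)\<^sup>+" for z
    using that
  proof induction
    case (base y)
    then show ?case using step[OF base] h[of y] mem[OF base] hu by auto
  next
    case (step y z)
    then show ?case using \<open>\<And>y z. (y, z) \<in> \<Union>\<Theta> \<Longrightarrow> (?h y, ?h z) \<in> \<Union>\<Theta>\<close>[OF step(2)] h[of z] mem[OF step(2)]
      by auto
  qed
  from this[OF uv(2)] show ?thesis using d(3) by (auto simp: inf_absorb2 less_imp_le)
qed

lemma prime_con:
  assumes "sublattice M UNIV" "prime_interval M p"
  shows "lattice_congruence M (con M p)" "p \<in> con M p"
  using lattice_congruence_con[OF assms(1)] prime_intervalD[OF assms(2)] by auto

section \<open>Existence of covers in finite lattices\<close>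

lemma finite_upper_cover:
  assumes "finite M" "x \<in> M" "y \<in> M" "(x::'a::lattice) < y"
  obtains z where "covered_by M x z" "z \<le> y"
proof -
  have "finite {z \<in> M. x < z \<and> z \<le> y}" "y \<in> {z \<in> M. x < z \<and> z \<le> y}" using assms by auto
  then obtain z where z: "z \<in> {z \<in> M. x < z \<and> z \<le> y}"
      "\<And>w. w \<in> {z \<in> M. x < z \<and> z \<le> y} \<Longrightarrow> w \<le> z \<Longrightarrow> z = w"
    using finite_has_minimal2 by (metis (no_types, lifting))
  have "covered_by M x z"
    unfolding covered_by_def using z assms by (auto dest: less_imp_le) (metis less_le_not_le order_trans)
  with z that show thesis by auto
qed

lemma finite_lower_cover:
  assumes "finite M" "x \<in> M" "y \<in> M" "(x::'a::lattice) < y"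
  obtains z where "covered_by M z y" "x \<le> z"
proof -
  have "finite {z \<in> M. x \<le> z \<and> z < y}" "x \<in> {z \<in> M. x \<le> z \<and> z < y}" using assms by auto
  then obtain z where z: "z \<in> {z \<in> M. x \<le> z \<and> z < y}"
      "\<And>w. w \<in> {z \<in> M. x \<le> z \<and> z < y} \<Longrightarrow> z \<le> w \<Longrightarrow> z = w"
    using finite_has_maximal2 by (metis (no_types, lifting))
  have "covered_by M z y"
    unfolding covered_by_def using z assms by (auto dest: less_imp_le) (metis less_le_not_le order_trans)
  with z that show thesis by auto
qed

section \<open>Swings, switches and paths\<close>

lemma generated_sublattice_closed:
  assumes "x \<in> generated_sublattice M X" "y \<in> generated_sublattice M X"
  shows "sup x y \<in> generated_sublattice M X" "inf x y \<in> generated_sublattice M X"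
  using assms unfolding generated_sublattice_def sublattice_def by auto

lemma subset_generated_sublattice: "X \<subseteq> generated_sublattice M X"
  unfolding generated_sublattice_def by auto

text \<open>\<open>A\<close>, a proper join below the top, must be \<open>S7_a\<close>, so
  \<open>P\<close> and \<open>C\<close> are \<open>S7_x\<close> and \<open>S7_m\<close>, whose meet
  \<open>S7_u\<close> lies below \<open>A\<close>. The order relation is written as an equation, a
  form that a homomorphism transports.\<close>

lemma s7_three_dual_atoms:
  assumes "sup P A = sup P C" "sup A C = sup P C" "P \<noteq> A" "P \<noteq> C" "A \<noteq> (C::s7)"
    "sup P A \<noteq> P" "sup P A \<noteq> A" "sup P A \<noteq> C" "A = sup v w" "v \<noteq> A" "w \<noteq> A"
  shows "sup (inf P C) A = A"
proof -
  have "sup v w \<in> {v, w, S7_a, S7_i}"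
    by (cases v; cases w; simp add: sup_s7_def less_eq_s7_def)
  moreover have "A \<noteq> S7_i"
    using assms(7) by (auto simp: sup_s7_def less_eq_s7_def)
  ultimately have A: "A = S7_a" using assms(9-11) by auto
  show ?thesis
    using assms(1-8) unfolding A
    by (cases P; cases C; simp add: sup_s7_def inf_s7_def less_eq_s7_def doubleton_eq_iff)
qed

lemma covers_sup:
  assumes "sublattice M UNIV" "covered_by M x z" "covered_by M y z" "x \<noteq> y"
  shows "sup x y = z"
proof -
  note d = covered_byD[OF assms(2)] covered_byD[OF assms(3)]
  have le: "sup x y \<in> M" "sup x y \<le> z"
    using sublatticeD(1)[OF assms(1)] d by (auto simp: less_imp_le)
  have "sup x y = x \<or> sup x y = z" "sup x y = y \<or> sup x y = z"
    using d(4,8)[of "sup x y"] le by auto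
  then show ?thesis using assms(4) by metis
qed

text \<open>The third dual atom \<open>C\<close> carries the collapse: meeting \<open>(P, t)\<close>
  with \<open>C\<close> gives \<open>(inf P C, C)\<close>, and joining with \<open>A\<close> gives
  \<open>(A, t)\<close>, because \<open>inf P C\<close> lies below \<open>A\<close> in an
  \<open>S7\<close> whose dual atom \<open>A\<close> is a proper join.\<close>

lemma swings_congruence:
  assumes M: "sublattice M UNIV" and \<theta>: "lattice_congruence M \<theta>" and sw: "swings M p q" and p: "p \<in> \<theta>"
  shows "q \<in> \<theta>"
proof -
  obtain P A t where pq: "p = (P, t)" "q = (A, t)" and PA: "P \<noteq> A"
    using sw unfolding swings_def by (metis prod.collapse)
  obtain C S where C: "covered_by M C t" "C \<noteq> P" "C \<noteq> A" and S: "S = generated_sublattice M {P, A, C}"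
    and iso: "lattice_isomorphic S (UNIV :: s7 set)" and pj: "proper_join S A"
    using sw unfolding swings_def pq by auto
  have P: "covered_by M P t" and A: "covered_by M A t"
    using sw unfolding swings_def prime_interval_def pq by auto
  obtain f where f: "bij_betw f S (UNIV :: s7 set)"
    and hom: "\<And>x y. x \<in> S \<Longrightarrow> y \<in> S \<Longrightarrow> f (sup x y) = sup (f x) (f y) \<and> f (inf x y) = inf (f x) (f y)"
    using iso unfolding lattice_isomorphic_def by auto
  have inj: "f x = f y \<longleftrightarrow> x = y" if "x \<in> S" "y \<in> S" for x y
    using f that by (auto simp: bij_betw_def inj_on_eq_iff)
  have mem: "P \<in> S" "A \<in> S" "C \<in> S" using subset_generated_sublattice[of "{P, A, C}" M] S by auto
  note cl = generated_sublattice_closed[of _ M "{P, A, C}", folded S]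
  have sups: "sup P A = t" "sup P C = t" "sup A C = t"
    using covers_sup[OF M] P A C PA by auto
  have t: "t \<in> S" using cl(1)[OF mem(1,2)] sups by simp
  obtain v w where vw: "v \<in> S" "w \<in> S" "v \<noteq> A" "w \<noteq> A" "A = sup v w"
    using pj unfolding proper_join_def by auto
  \<comment> \<open>The order relation is computed in the model and pulled back along the injective
    \<open>f\<close>.\<close>
  have "sup (inf (f P) (f C)) (f A) = f A"
  proof (rule s7_three_dual_atoms)
    show "f A = sup (f v) (f w)" using hom vw by auto
    have "f t \<noteq> f P" "f t \<noteq> f A" "f t \<noteq> f C"
      using inj t mem covered_byD(3)[OF P] covered_byD(3)[OF A] covered_byD(3)[OF C(1)] by auto
    moreover have "sup (f P) (f A) = f t" "sup (f P) (f C) = f t" "sup (f A) (f C) = f t"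
      using hom mem sups by metis+
    ultimately show "sup (f P) (f A) = sup (f P) (f C)" "sup (f A) (f C) = sup (f P) (f C)"
      "sup (f P) (f A) \<noteq> f P" "sup (f P) (f A) \<noteq> f A" "sup (f P) (f A) \<noteq> f C"
      by auto
    show "f P \<noteq> f A" "f P \<noteq> f C" "f A \<noteq> f C" "f v \<noteq> f A" "f w \<noteq> f A"
      using inj mem vw C PA by auto
  qed
  then have "f (sup (inf P C) A) = f A"
    using hom mem cl by simp
  then have le: "sup (inf P C) A = A"
    using inj mem cl by simp
  have "(inf P C, inf t C) \<in> \<theta>"
    using p lattice_congruenceD(7)[OF \<theta>] covered_byD(1)[OF C(1)] unfolding pq by auto
  then have "(sup (inf P C) A, sup (inf t C) A) \<in> \<theta>"
    using lattice_congruenceD(6)[OF \<theta>] covered_byD(1)[OF A] by auto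
  then show ?thesis
    using le sups(3) covered_byD(3)[OF C(1)] unfolding pq
    by (simp add: inf_absorb2 less_imp_le sup_commute)
qed

text \<open>Meeting with \<open>snd s\<close> takes \<open>r\<close> to \<open>s\<close>, and
  joining with \<open>fst r\<close> takes \<open>s\<close> back to \<open>r\<close>. Both directions
  matter: an SPS projection opens with an up perspectivity and continues with down ones.\<close>

lemma down_perspective_congruence:
  assumes \<theta>: "lattice_congruence M \<theta>" and "prime_interval M r" "prime_interval M s" "down_perspective r s"
  shows "r \<in> \<theta> \<longleftrightarrow> s \<in> \<theta>"
proof -
  obtain r0 r1 s0 s1 where rs: "r = (r0, r1)" "s = (s0, s1)" by (metis prod.exhaust)
  note d = prime_intervalD[OF assms(2)] prime_intervalD[OF assms(3)]
  have e: "sup r0 s1 = r1" "inf r0 s1 = s0" using assms(4) unfolding down_perspective_def rs by auto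
  have "s1 \<le> r1" "s0 \<le> r0" using e by auto
  then have "inf r1 s1 = s1" "sup r0 s0 = r0" by (auto simp: inf_absorb2 sup_absorb1)
  then show ?thesis
    using lattice_congruenceD(7)[OF \<theta>, of r0 r1 s1] lattice_congruenceD(8)[OF \<theta>, of s0 s1 r0] d e
    unfolding rs by auto
qed

lemma sps_steps_congruence:
  assumes "sublattice M UNIV" "lattice_congruence M \<theta>" "(sps_step M)\<^sup>*\<^sup>* r q" "r \<in> \<theta>"
  shows "q \<in> \<theta>"
  using assms(3,4)
proof induction
  case (step y z)
  then show ?case
    using down_perspective_congruence[OF assms(2), of y z] swings_congruence[OF assms(1,2), of y z]
    unfolding sps_step_def by blast
qed

lemma sps_projective_congruence:
  assumes "sublattice M UNIV" "lattice_congruence M \<theta>" "prime_interval M p" "sps_projective M p q" "p \<in> \<theta>"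
  shows "q \<in> \<theta>"
  using assms sps_steps_congruence down_perspective_congruence
  unfolding sps_projective_def up_perspective_def by blast

text \<open>This is the simplicity of M3: any nontrivial collapse reaches the bottom and an atom,
  and alternating joins and meets with three atoms spread it to bottom and top. \<open>R\<close> is
  an arbitrary relation, so that a congruence transported along an isomorphism fits.\<close>

lemma M3_simple:
  assumes refl: "\<And>x. x \<in> Mn 3 \<Longrightarrow> R x x"
    and sym: "\<And>x y. R x y \<Longrightarrow> R y x" and tr: "\<And>x y z. R x y \<Longrightarrow> R y z \<Longrightarrow> R x z"
    and s: "\<And>x y z. x \<in> Mn 3 \<Longrightarrow> y \<in> Mn 3 \<Longrightarrow> z \<in> Mn 3 \<Longrightarrow> R x y \<Longrightarrow> R (sup x z) (sup y z)"
    and i: "\<And>x y z. x \<in> Mn 3 \<Longrightarrow> y \<in> Mn 3 \<Longrightarrow> z \<in> Mn 3 \<Longrightarrow> R x y \<Longrightarrow> R (inf x z) (inf y z)"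
    and xy: "x \<in> Mn 3" "y \<in> Mn 3" "x \<noteq> y" "R x y"
    and zw: "z \<in> Mn 3" "w \<in> Mn 3"
  shows "R z w"
proof -
  note simps = sup_mn_def inf_mn_def less_eq_mn_def
  have mem [simp]: "Mn_bot \<in> Mn 3" "Mn_top \<in> Mn 3" "Mn_atom k \<in> Mn 3 \<longleftrightarrow> k < 3" for k
    by (auto simp: Mn_def)
  have from_bot: "R Mn_bot Mn_top" if "R Mn_bot (Mn_atom k)" "k < 3" for k
  proof -
    obtain j l where jl: "j < 3" "l < 3" "j \<noteq> k" "l \<noteq> k" "j \<noteq> l"
    proof (cases "k = 0")
      case True
      then show ?thesis using that[of 1 2] by simp
    next
      case False
      then show ?thesis using that[of 0 "if k = 1 then 2 else 1"] by (simp split: if_splits)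
    qed
    \<comment> \<open>Joining \<open>(Mn_bot, Mn_atom k)\<close> with atom \<open>j\<close>, meeting
      with atom \<open>l\<close> and joining with atom \<open>k\<close> climbs to
      \<open>(Mn_atom k, Mn_top)\<close>; here the third atom is essential.\<close>
    have "R (Mn_atom j) Mn_top" using s[OF _ _ _ that(1), of "Mn_atom j"] that(2) jl by (simp add: simps)
    then have "R Mn_bot (Mn_atom l)" using i[of "Mn_atom j" Mn_top "Mn_atom l"] jl by (simp add: simps)
    then have "R (Mn_atom k) Mn_top" using s[of "Mn_bot" "Mn_atom l" "Mn_atom k"] jl that by (simp add: simps)
    then show ?thesis using tr that(1) by blast
  qed
  have from_top: "R Mn_bot Mn_top" if "R (Mn_atom k) Mn_top" "k < 3" for k
  proof -
    have "(if k = 0 then 1 else 0) < (3::nat)" "(if k = 0 then 1 else 0) \<noteq> k" by auto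
    then obtain j where j: "j < 3" "j \<noteq> k" by blast
    have "R Mn_bot (Mn_atom j)" using i[OF _ _ _ that(1), of "Mn_atom j"] that j by (simp add: simps)
    then show ?thesis using from_bot j by blast
  qed
  have "R Mn_bot Mn_top"
  proof (cases "x = Mn_bot \<or> y = Mn_bot \<or> x = Mn_top \<or> y = Mn_top")
    case True
    then show ?thesis using xy from_bot from_top sym by (cases x; cases y) auto
  next
    case False
    then obtain k l where kl: "x = Mn_atom k" "y = Mn_atom l" by (cases x; cases y) auto
    then have "R Mn_bot (Mn_atom l)" using i[OF xy(1,2,2,4)] xy by (simp add: simps)
    then show ?thesis using from_bot xy kl by simp
  qed
  then have "R Mn_bot z" if "z \<in> Mn 3" for z
    using i[of Mn_bot Mn_top z] that by (cases z) (auto simp: simps)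
  then show ?thesis using zw sym tr by blast
qed

lemma switches_congruence:
  assumes M: "sublattice M UNIV" and \<theta>: "lattice_congruence M \<theta>" and sw: "switches M p q" and p: "p \<in> \<theta>"
  shows "q \<in> \<theta>"
proof -
  obtain S where S: "covering_M3 M S" "{fst p, snd p, fst q, snd q} \<subseteq> S"
    and pr: "prime_interval M p"
    using sw unfolding switches_def by auto
  obtain f where f: "bij_betw f S (Mn 3)"
    and hom: "\<And>x y. x \<in> S \<Longrightarrow> y \<in> S \<Longrightarrow> f (sup x y) = sup (f x) (f y) \<and> f (inf x y) = inf (f x) (f y)"
    and sub: "sublattice S M"
    using S(1) unfolding covering_M3_def lattice_isomorphic_def by auto
  \<comment> \<open>\<open>R\<close> is \<open>\<theta>\<close> restricted to the covering M3 and
    transported along \<open>f\<close>; simplicity forces it to collapse everything.\<close>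
  define R where "R x y \<longleftrightarrow> (\<exists>v\<in>S. \<exists>w\<in>S. f v = x \<and> f w = y \<and> (v, w) \<in> \<theta>)" for x y
  have inj: "f x = f y \<longleftrightarrow> x = y" if "x \<in> S" "y \<in> S" for x y
    using f that by (auto simp: bij_betw_def inj_on_eq_iff)
  have R: "R (f v) (f w) \<longleftrightarrow> (v, w) \<in> \<theta>" if "v \<in> S" "w \<in> S" for v w
    unfolding R_def using that inj by auto
  have im: "x \<in> Mn 3 \<longleftrightarrow> (\<exists>v\<in>S. x = f v)" for x
    using f by (auto simp: bij_betw_def)
  have "R (f (fst q)) (f (snd q))"
  proof (rule M3_simple[of R])
    show "R (f (fst p)) (f (snd p))" using R S(2) p by simp
    show "f (fst p) \<noteq> f (snd p)" using inj S(2) prime_intervalD[OF pr] by auto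
  next
    fix x y z assume "x \<in> Mn 3" "y \<in> Mn 3" "z \<in> Mn 3"
    then obtain v w u where vw: "v \<in> S" "w \<in> S" "u \<in> S" "x = f v" "y = f w" "z = f u"
      by (auto simp: im)
    assume "R x y"
    then have "(v, w) \<in> \<theta>" using R vw by simp
    then have "(sup v u, sup w u) \<in> \<theta>" "(inf v u, inf w u) \<in> \<theta>"
      using lattice_congruenceD(6,7)[OF \<theta>] sublatticeD(3)[OF sub] vw by auto
    then show "R (sup x z) (sup y z)" "R (inf x z) (inf y z)"
      using R[of "sup v u" "sup w u"] R[of "inf v u" "inf w u"] sublatticeD[OF sub] vw hom by auto
  next
    show "R x x" if "x \<in> Mn 3" for x
      using that R lattice_congruenceD(3)[OF \<theta>] sublatticeD(3)[OF sub] by (auto simp: im)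
    show "R y x" if "R x y" for x y
      using that lattice_congruenceD(4)[OF \<theta>] unfolding R_def by blast
    fix x y z assume "R x y" "R y z"
    then obtain v w w' u where vw: "v \<in> S" "w \<in> S" "w' \<in> S" "u \<in> S" "x = f v" "y = f w" "f w' = f w" "z = f u"
      "(v, w) \<in> \<theta>" "(w', u) \<in> \<theta>"
      unfolding R_def by metis
    then show "R x z" using inj R lattice_congruenceD(5)[OF \<theta>] by auto
  qed (use S(2) im in auto)
  then show ?thesis using R S(2) by simp
qed

text \<open>The sequences of the General Swing Lemma. SPS projections alternate with switches,
  so paths compose only through a switch.\<close>

inductive swing_path :: "'a::lattice set \<Rightarrow> 'a \<times> 'a \<Rightarrow> 'a \<times> 'a \<Rightarrow> bool" for M where
  base: "prime_interval M p \<Longrightarrow> prime_interval M q \<Longrightarrow> sps_projective M p q \<Longrightarrow> swing_path M p q"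
| step: "swing_path M p q \<Longrightarrow> switches M q r \<Longrightarrow> prime_interval M s \<Longrightarrow> sps_projective M r s \<Longrightarrow>
    swing_path M p s"

lemma swing_path_refl: "prime_interval M p \<Longrightarrow> swing_path M p p"
  by (auto intro: base simp: sps_projective_def)

lemma swing_path_switch: "swing_path M p q \<Longrightarrow> switches M q r \<Longrightarrow> swing_path M p r"
  by (rule step) (auto simp: sps_projective_def switches_def)

lemma swing_path_trans:
  assumes "swing_path M p q" "switches M q r" "swing_path M r s"
  shows "swing_path M p s"
  using assms(3,2) by induction (auto intro: step assms(1))

text \<open>Only the last SPS projection grows by a step. If it is trivial, it has no opening up
  perspectivity, and the perspectivity of \<open>q\<close> to itself fills the gap.\<close>

lemma swing_path_sps_step:
  assumes "swing_path M p q" "sps_step M q r"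
  shows "swing_path M p r"
proof -
  have ext: "sps_projective M s r" if "sps_projective M s q" for s
  proof (cases "s = q")
    case True
    have "up_perspective q q"
      using assms(2) prime_intervalD(3)[of M q]
      by (simp add: sps_step_def up_perspective_def down_perspective_def sup_absorb2 inf_absorb1 less_imp_le)
    then show ?thesis
      using True assms(2) unfolding sps_projective_def sps_step_def[of M q r]
      by (meson assms(2) r_into_rtranclp)
  next
    case False
    then show ?thesis
      using that assms(2) unfolding sps_projective_def by (meson rtranclp.rtrancl_into_rtrancl)
  qed
  have "prime_interval M r" using assms(2) by (simp add: sps_step_def)
  with assms(1) ext show ?thesis by cases (metis ext swing_path.intros)+
qed

lemma swing_path_congruence:
  assumes M: "sublattice M UNIV" and \<theta>: "lattice_congruence M \<theta>" and "swing_path M p q" "p \<in> \<theta>"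
  shows "q \<in> \<theta>"
  using assms(3,4)
proof induction
  case (base p q)
  then show ?case using sps_projective_congruence[OF M \<theta>] by blast
next
  case (step p q r s)
  then have "r \<in> \<theta>" using switches_congruence[OF M \<theta>] by blast
  moreover have "prime_interval M r" using step by (simp add: switches_def)
  ultimately show ?case using sps_projective_congruence[OF M \<theta>] step by blast
qed

text \<open>The inductive form suits composition; this converts it to indexed sequences,
  \<open>P k\<close> and \<open>Q k\<close> being the ends of the \<open>k\<close>-th SPS
  projection.\<close>

lemma swing_path_iff_sequences:
  "swing_path M p q \<longleftrightarrow>
     (\<exists>(n::nat) P Q.
        (\<forall>k\<le>n. prime_interval M (P k) \<and> prime_interval M (Q k)) \<and>
        P 0 = p \<and> Q n = q \<and>
        (\<forall>k\<le>n. sps_projective M (P k) (Q k)) \<and>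
        (\<forall>k<n. switches M (Q k) (P (Suc k))))" (is "_ \<longleftrightarrow> ?seq p q")
proof
  assume "swing_path M p q"
  then show "?seq p q"
  proof induction
    case (base p q)
    then show ?case by (intro exI[of _ 0] exI[of _ "\<lambda>_. p"] exI[of _ "\<lambda>_. q"]) auto
  next
    case (step p q r s)
    then obtain n :: nat and P Q where PQ: "\<forall>k\<le>n. prime_interval M (P k) \<and> prime_interval M (Q k)"
        "P 0 = p" "Q n = q" "\<forall>k\<le>n. sps_projective M (P k) (Q k)"
        "\<forall>k<n. switches M (Q k) (P (Suc k))"
      by auto
    have "prime_interval M r" using step by (simp add: switches_def)
    with PQ step show ?case
      by (intro exI[of _ "Suc n"] exI[of _ "P(Suc n := r)"] exI[of _ "Q(Suc n := s)"])
        (auto simp: le_Suc_eq less_Suc_eq)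
  qed
next
  assume "?seq p q"
  then obtain n :: nat and P Q where PQ: "\<forall>k\<le>n. prime_interval M (P k) \<and> prime_interval M (Q k)"
      "P 0 = p" "Q n = q" "\<forall>k\<le>n. sps_projective M (P k) (Q k)"
      "\<forall>k<n. switches M (Q k) (P (Suc k))"
    by auto
  have "swing_path M p (Q k)" if "k \<le> n" for k
    using that
  proof (induction k)
    case 0
    then show ?case using PQ base by blast
  next
    case (Suc k)
    then show ?case using PQ step[of M p "Q k" "P (Suc k)" "Q (Suc k)"] by simp
  qed
  then show "swing_path M p q" using PQ by blast
qed

text \<open>The other direction is automatic: SPS projections and switches never leave a congruence
  that collapses their start.\<close>

lemma satisfies_general_swing_lemmaI:
  assumes M: "sublattice M UNIV"
    and path: "\<And>p q. prime_interval M p \<Longrightarrow> prime_interval M q \<Longrightarrow> q \<in> con M p \<Longrightarrow> swing_path M p q"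
  shows "satisfies_general_swing_lemma M"
  unfolding satisfies_general_swing_lemma_def swing_path_iff_sequences[symmetric]
  using path swing_path_congruence[OF M] prime_con[OF M] by blast

section \<open>Sublattices of shape \<open>M\<^sub>3\<close> and \<open>S\<^sub>7\<close>\<close>

text \<open>The map runs from the model to the lattice, so that it can be defined by cases on
  constructors; its inverse is a homomorphism because the model is closed under the
  operations.\<close>

lemma lattice_isomorphicI:
  assumes g: "bij_betw g B A"
    and hom: "\<And>x y. x \<in> B \<Longrightarrow> y \<in> B \<Longrightarrow> g (sup x y) = sup (g x) (g y) \<and> g (inf x y) = inf (g x) (g y)"
    and cl: "\<And>x y. x \<in> B \<Longrightarrow> y \<in> B \<Longrightarrow> sup x y \<in> B \<and> inf x y \<in> B"
  shows "lattice_isomorphic A B"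
proof -
  let ?f = "inv_into B g"
  have f: "?f (g x) = x" if "x \<in> B" for x
    using g that by (simp add: bij_betw_def)
  have "?f (sup x y) = sup (?f x) (?f y) \<and> ?f (inf x y) = inf (?f x) (?f y)" if xy: "x \<in> A" "y \<in> A" for x y
  proof -
    obtain v w where vw: "v \<in> B" "w \<in> B" "x = g v" "y = g w"
      using g xy unfolding bij_betw_def by blast
    then show ?thesis using hom[of v w] f cl by metis
  qed
  then show ?thesis
    unfolding lattice_isomorphic_def using bij_betw_inv_into[OF g] by blast
qed

lemma lattice_isomorphic_M3:
  fixes b x y z t :: "'a::lattice"
  assumes le: "b < x" "b < y" "b < z" "x < t" "y < t" "z < t"
    and ne: "x \<noteq> y" "x \<noteq> z" "y \<noteq> z"
    and sup: "sup x y = t" "sup x z = t" "sup y z = t"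
    and inf: "inf x y = b" "inf x z = b" "inf y z = b"
  shows "lattice_isomorphic {b, x, y, z, t} (Mn 3)"
proof (rule lattice_isomorphicI)
  have Mn: "Mn 3 = {Mn_bot, Mn_top, Mn_atom 0, Mn_atom 1, Mn_atom 2}"
    by (auto simp: Mn_def numeral_3_eq_3 numeral_2_eq_2 lessThan_Suc)
  define g where "g p = (case p of Mn_bot \<Rightarrow> b | Mn_atom k \<Rightarrow> if k = 0 then x else if k = 1 then y else z
      | Mn_top \<Rightarrow> t)" for p
  have bt: "b < t" using le by auto
  have g: "g Mn_bot = b" "g Mn_top = t" "g (Mn_atom 0) = x" "g (Mn_atom 1) = y" "g (Mn_atom 2) = z"
    by (auto simp: g_def)
  show "bij_betw g (Mn 3) {b, x, y, z, t}"
    unfolding bij_betw_def inj_on_def Mn using le ne bt by (auto simp: g simp del: One_nat_def)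
  show "g (sup p q) = sup (g p) (g q) \<and> g (inf p q) = inf (g p) (g q)" if "p \<in> Mn 3" "q \<in> Mn 3" for p q
    using that le bt sup inf unfolding Mn
    by (auto simp: g sup_mn_def inf_mn_def less_eq_mn_def sup_absorb1 sup_absorb2 inf_absorb1 inf_absorb2
        less_imp_le sup_commute inf_commute simp del: One_nat_def)
  show "sup p q \<in> Mn 3 \<and> inf p q \<in> Mn 3" if "p \<in> Mn 3" "q \<in> Mn 3" for p q
    using that unfolding Mn by (auto simp: sup_mn_def inf_mn_def)
qed

text \<open>The elements \<open>u, y, v, x, a, c, t\<close> take the places
  \<open>u, y, o, x, a, m, i\<close> of \<open>S7\<close>. Joins of two dual atoms need no
  assumption of their own: distinct lower covers of \<open>t\<close> join to
  \<open>t\<close>.\<close>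

lemma swings_S7:
  fixes u y v x a c t :: "'a::lattice"
  assumes M: "sublattice M UNIV" and cov: "covered_by M x t" "covered_by M a t" "covered_by M c t"
    and dist: "distinct [u, y, v, x, a, c, t]"
    and sups: "sup y v = a" "sup y c = t" "sup v x = t"
    and infs: "inf y v = u" "inf y c = u" "inf v x = u" "inf x a = y" "inf x c = u" "inf a c = v"
  shows "swings M (x, t) (a, t)"
proof -
  define g where "g p = (case p of S7_u \<Rightarrow> u | S7_y \<Rightarrow> y | S7_o \<Rightarrow> v | S7_x \<Rightarrow> x | S7_a \<Rightarrow> a
      | S7_m \<Rightarrow> c | S7_i \<Rightarrow> t)" for p
  have g: "g S7_u = u" "g S7_y = y" "g S7_o = v" "g S7_x = x" "g S7_a = a" "g S7_m = c" "g S7_i = t"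
    by (auto simp: g_def)
  have mem: "x \<in> M" "a \<in> M" "c \<in> M" "t \<in> M" using cov covered_byD by blast+
  have le: "x \<le> t" "a \<le> t" "c \<le> t" using cov covered_byD(3) by (blast intro: less_imp_le)+
  have le2: "u \<le> y" "u \<le> v" "y \<le> x" "y \<le> a" "v \<le> a" "v \<le> c"
    using infs by (metis inf_le1 inf_le2)+
  have le3: "u \<le> x" "u \<le> a" "u \<le> c" "u \<le> t" "y \<le> t" "v \<le> t"
    using le le2 by (metis order_trans)+
  have sups2: "sup x a = t" "sup x c = t" "sup a c = t"
    using covers_sup[OF M] cov dist by auto
  note all_le = le le2 le3
  \<comment> \<open>Comparable pairs follow from monotonicity of \<open>g\<close>; the incomparable
    ones are looked up in the given table.\<close>
  have hom: "g (sup p q) = sup (g p) (g q) \<and> g (inf p q) = inf (g p) (g q)" for p q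
  proof -
    have mono: "g p \<le> g q" if "p \<le> q" for p q
      using that by (cases p; cases q; simp add: g less_eq_s7_def all_le)
    have "sup a x = t" "sup c x = t" "sup c a = t" "inf a x = y" "inf c x = u" "inf c a = v"
      "sup v y = a" "sup c y = t" "sup x v = t" "inf v y = u" "inf c y = u" "inf x v = u"
      using sups sups2 infs by (metis sup_commute inf_commute)+
    note eqs = sups sups2 infs this
    show ?thesis
    proof (cases "p \<le> q \<or> q \<le> p")
      case True
      then show ?thesis using mono
        by (auto simp: sup_absorb1 sup_absorb2 inf_absorb1 inf_absorb2)
    next
      case False
      then show ?thesis
        by (cases p; cases q; simp add: eqs g sup_s7_def inf_s7_def less_eq_s7_def doubleton_eq_iff)
    qed
  qed
  have inj: "g p = g q \<longleftrightarrow> p = q" for p q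
    using dist by (cases p; cases q) (auto simp: g)
  have g_le: "g p \<le> g q \<longleftrightarrow> p \<le> q" for p q
    using hom inj by (metis le_iff_sup)
  have g_less: "g p < g q \<longleftrightarrow> p < q" for p q
    using g_le by (simp add: less_le_not_le)
  have gM: "g p \<in> M" for p
    using mem infs sublatticeD(2)[OF M] by (cases p) (auto simp: g)
  have sub: "sublattice (range g) M"
    unfolding sublattice_def using gM by (auto simp: hom[THEN conjunct1, symmetric] hom[THEN conjunct2, symmetric])
  \<comment> \<open>Meets of the dual atoms recover \<open>u\<close>, \<open>y\<close> and
    \<open>v\<close>, and a join recovers \<open>t\<close>.\<close>
  have gen: "generated_sublattice M {x, a, c} = range g"
  proof
    show "generated_sublattice M {x, a, c} \<subseteq> range g"
      unfolding generated_sublattice_def using sub g by blast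
    have "g p \<in> generated_sublattice M {x, a, c}" for p
    proof -
      note cl = generated_sublattice_closed[of _ M "{x, a, c}"]
      have 1: "x \<in> generated_sublattice M {x, a, c}" "a \<in> generated_sublattice M {x, a, c}"
        "c \<in> generated_sublattice M {x, a, c}"
        using subset_generated_sublattice[of "{x, a, c}" M] by auto
      have "sup x a \<in> generated_sublattice M {x, a, c}" "inf x a \<in> generated_sublattice M {x, a, c}"
        "inf x c \<in> generated_sublattice M {x, a, c}" "inf a c \<in> generated_sublattice M {x, a, c}"
        using 1 by (blast intro: cl)+
      with 1 show ?thesis using sups2 infs by (cases p) (auto simp: g)
    qed
    then show "range g \<subseteq> generated_sublattice M {x, a, c}" by blast
  qed
  have iso: "lattice_isomorphic (range g) (UNIV :: s7 set)"
    by (rule lattice_isomorphicI[where g = g]) (use hom inj in \<open>auto simp: bij_betw_def inj_on_def\<close>)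
  \<comment> \<open>\<open>g\<close> is an order embedding, so the question moves to
    \<open>S7\<close>, where the only proper joins are \<open>S7_a\<close> and
    \<open>S7_i\<close>.\<close>
  have "dual_atom (range g) d \<and> proper_join (range g) d \<longleftrightarrow> d = a" for d
  proof
    assume d: "dual_atom (range g) d \<and> proper_join (range g) d"
    then obtain p i where p: "d = g p" "covered_by (range g) (g p) (g i)" "\<And>q. g q \<le> g i"
      unfolding dual_atom_def covered_by_def by fast
    have "S7_i \<le> i" using p(3)[of S7_i] g_le by simp
    then have i: "i = S7_i" by (cases i) (auto simp: less_eq_s7_def)
    have p': "p < S7_i" "\<not> (\<exists>q. p < q \<and> q < S7_i)" using p(2) unfolding covered_by_def i by (auto simp: g_less)
    obtain q r where "g p = sup (g q) (g r)" "g q \<noteq> g p" "g r \<noteq> g p"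
      using d unfolding p(1) proper_join_def by fastforce
    then have qr: "p = sup q r" "q \<noteq> p" "r \<noteq> p" using hom inj by metis+
    have "sup q r \<in> {q, r, S7_a, S7_i}"
      by (cases q; cases r; simp add: sup_s7_def less_eq_s7_def)
    then have "p = S7_a" using qr p' by auto
    then show "d = a" using p g by simp
  next
    assume "d = a"
    then have d: "d = g S7_a" by (simp add: g)
    have "\<not> (\<exists>q. S7_a < q \<and> q < S7_i)"
    proof
      assume "\<exists>q. S7_a < q \<and> q < S7_i"
      then obtain q where "S7_a < q \<and> q < S7_i" ..
      then show False by (cases q) (auto simp: less_s7_def less_eq_s7_def)
    qed
    then have "covered_by (range g) d (g S7_i)"
      unfolding covered_by_def d by (auto simp: g_less) (simp add: less_s7_def less_eq_s7_def)
    moreover have "\<forall>q\<in>range g. q \<le> g S7_i" by (auto simp: g_le less_eq_s7_def)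
    moreover have "proper_join (range g) d"
      unfolding proper_join_def d
      by (rule bexI[of _ "g S7_y"], rule bexI[of _ "g S7_o"]) (use sups in \<open>auto simp: inj\<close>, auto simp: g)
    ultimately show "dual_atom (range g) d \<and> proper_join (range g) d"
      unfolding dual_atom_def by blast
  qed
  then show ?thesis
    unfolding swings_def prime_interval_def fst_conv snd_conv
    using cov dist iso gen by (intro conjI exI[of _ c] exI[of _ "range g"]) auto
qed

section \<open>A lattice with a tab\<close>

text \<open>Double irreducibility of \<open>m\<close> enters as \<open>below_m\<close> and
  \<open>above_m\<close>: in a finite lattice, whatever lies strictly below (above) \<open>m\<close>
  lies below (above) its only lower (upper) cover. \<open>diamond\<close> describes the interior of
  \<open>[b, t]\<close>, and \<open>other_atoms\<close> records that it has at least three atoms,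
  \<open>m\<close> included.\<close>

locale tab_diamond =
  fixes M :: "'a::lattice set" and m b t :: 'a
  assumes sub: "sublattice M UNIV" and fin: "finite M" and smod: "semimodular M"
    and mem: "m \<in> M" "b \<in> M" "t \<in> M" and b_less_m: "b < m" and m_less_t: "m < t"
    and below_m: "z \<in> M \<Longrightarrow> z < m \<Longrightarrow> z \<le> b" and above_m: "z \<in> M \<Longrightarrow> m < z \<Longrightarrow> t \<le> z"
    and diamond: "z \<in> M \<Longrightarrow> w \<in> M \<Longrightarrow> b < z \<Longrightarrow> z < t \<Longrightarrow> b < w \<Longrightarrow> w < t \<Longrightarrow> z \<noteq> w \<Longrightarrow>
      sup z w = t \<and> inf z w = b"
    and other_atoms: "\<exists>x\<in>M - {m}. \<exists>y\<in>M - {m}. x \<noteq> y \<and> b < x \<and> x < t \<and> b < y \<and> y < t"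
begin

abbreviation N :: "'a set" where "N \<equiv> M - {m}"

definition atoms :: "'a set" where "atoms = {z \<in> N. b < z \<and> z < t}"

lemma atomsD:
  assumes "z \<in> atoms"
  shows "z \<in> N" "z \<in> M" "b < z" "z < t" "z \<noteq> m"
  using assms unfolding atoms_def by auto

lemma insert_atomsD:
  assumes "z \<in> insert m atoms"
  shows "z \<in> M" "b < z" "z < t"
  using assms atomsD[of z] mem b_less_m m_less_t by auto

lemma atom_sup_inf:
  assumes "z \<in> insert m atoms" "w \<in> insert m atoms" "z \<noteq> w"
  shows "sup z w = t \<and> inf z w = b"
  by (rule diamond) (use assms insert_atomsD in blast)+

lemma obtain_other_atom:
  obtains x where "x \<in> atoms" "x \<noteq> z"
  using other_atoms unfolding atoms_def by blast

section \<open>The stripped lattice \<open>N\<close> and its covers\<close>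

lemma bt_N: "b \<in> N" "t \<in> N" "b < t"
  using mem b_less_m m_less_t by auto

text \<open>\<open>m\<close> is neither a join nor a meet of other elements: two elements strictly
  below \<open>m\<close> join below \<open>b\<close>, and dually.\<close>

lemma sub_N: "sublattice N UNIV"
proof -
  have "sup x y \<noteq> m" "inf x y \<noteq> m" if xy: "x \<in> N" "y \<in> N" for x y
  proof -
    show "sup x y \<noteq> m"
    proof
      assume *: "sup x y = m"
      then have "x < m" "y < m" using xy by (auto simp: less_le)
      then have "sup x y \<le> b" using below_m xy by simp
      with * b_less_m show False by auto
    qed
    show "inf x y \<noteq> m"
    proof
      assume *: "inf x y = m"
      then have "m < x" "m < y" using xy by (auto simp: less_le)
      then have "t \<le> inf x y" using above_m xy by simp
      with * m_less_t show False by auto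
    qed
  qed
  then show ?thesis
    using sub bt_N unfolding sublattice_def by blast
qed

lemmas N_closed = sublatticeD(1,2)[OF sub_N]

text \<open>An element of \<open>N\<close> that is not below \<open>b\<close> is not below
  \<open>m\<close>, so its join with \<open>m\<close> passes \<open>m\<close> and hence reaches
  \<open>t\<close>. With the dual \<open>inf_m\<close>, this reduces every operation with
  \<open>m\<close> to one of \<open>N\<close> or to \<open>m\<close> itself.\<close>

lemma sup_m: "v \<in> N \<Longrightarrow> sup v m = (if v \<le> b then m else sup v t)"
proof -
  assume v: "v \<in> N"
  show ?thesis
  proof (cases "v \<le> b")
    case True
    then show ?thesis using b_less_m by (simp add: sup_absorb2)
  next
    case False
    then have "\<not> v \<le> m" using below_m v by (auto simp: le_less)
    then have "m < sup v m" by (metis le_iff_sup less_le sup_ge2)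
    then have "t \<le> sup v m" using above_m v mem sublatticeD(1)[OF sub] by blast
    then have "sup v m = sup v t" using m_less_t by (intro antisym) (auto intro: le_supI2 less_imp_le)
    with False show ?thesis by simp
  qed
qed

lemma inf_m: "v \<in> N \<Longrightarrow> inf v m = (if t \<le> v then m else inf v b)"
proof -
  assume v: "v \<in> N"
  show ?thesis
  proof (cases "t \<le> v")
    case True
    then show ?thesis using m_less_t by (simp add: inf_absorb2)
  next
    case False
    then have "\<not> m \<le> v" using above_m v by (auto simp: le_less)
    then have "inf v m < m" by (metis le_iff_inf less_le inf_commute inf_le2)
    then have "inf v m \<le> b" using below_m v mem sublatticeD(2)[OF sub] by blast
    then have "inf v m = inf v b" using b_less_m by (intro antisym) (auto intro: le_infI2 less_imp_le)
    with False show ?thesis by simp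
  qed
qed

text \<open>A new cover would have to jump over \<open>m\<close>; but then it spans
  \<open>[b, t]\<close>, where another atom remains.\<close>

lemma covered_by_N_iff:
  assumes "v \<in> N" "w \<in> N"
  shows "covered_by N v w \<longleftrightarrow> covered_by M v w"
proof -
  obtain x where x: "x \<in> atoms" using obtain_other_atom by blast
  have "v < x \<and> x < w" if "v < m" "m < w"
    using below_m[of v] above_m[of w] that assms atomsD[OF x] by (auto intro: le_less_trans less_le_trans)
  then have "\<exists>z\<in>N. v < z \<and> z < w" if "v < m" "m < w"
    using that atomsD(1)[OF x] by blast
  then show ?thesis
    using assms unfolding covered_by_def by blast
qed

lemma prime_interval_N: "prime_interval N p \<Longrightarrow> prime_interval M p"
  unfolding prime_interval_def using covered_by_N_iff covered_byD(1,2) by blast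

lemma semimodular_N: "semimodular N"
  unfolding semimodular_def
proof (intro ballI impI)
  fix x y z assume xyz: "x \<in> N" "y \<in> N" "z \<in> N" "covered_by N x y"
  then have "sup x z = sup y z \<or> covered_by M (sup x z) (sup y z)"
    using smod covered_by_N_iff unfolding semimodular_def by blast
  then show "sup x z = sup y z \<or> covered_by N (sup x z) (sup y z)"
    using covered_by_N_iff N_closed xyz by blast
qed

lemma atom_covers:
  assumes "z \<in> insert m atoms"
  shows "covered_by M b z" "covered_by M z t"
proof -
  note z = insert_atomsD[OF assms]
  have "w = z" if w: "w \<in> M" "b < w" "w < t" "w \<le> z \<or> z \<le> w" for w
  proof (rule ccontr)
    assume "w \<noteq> z"
    then have "sup w z = t \<and> inf w z = b" using diamond w z by blast
    then show False using w z by (auto simp: sup_absorb1 sup_absorb2 inf_absorb1 inf_absorb2)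
  qed
  then have "\<not> (b < w \<and> w < z)" "\<not> (z < w \<and> w < t)" if "w \<in> M" for w
    using that z by (metis less_imp_le less_trans order_less_irrefl)+
  then show "covered_by M b z" "covered_by M z t"
    unfolding covered_by_def using z mem by blast+
qed

lemma atom_primes_N:
  assumes "z \<in> atoms"
  shows "prime_interval N (b, z)" "prime_interval N (z, t)"
  unfolding prime_interval_def using atom_covers[of z] covered_by_N_iff bt_N atomsD(1) assms by auto

lemma new_primes:
  assumes "prime_interval M q" "\<not> prime_interval N q"
  shows "q = (b, m) \<or> q = (m, t)"
proof -
  have c: "covered_by M (fst q) (snd q)" using assms by (simp add: prime_interval_def)
  then have "fst q = m \<or> snd q = m"
    using assms(2) covered_by_N_iff covered_byD(1,2)[OF c] unfolding prime_interval_def by blast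
  then show ?thesis
  proof
    assume *: "fst q = m"
    then have "t \<le> snd q" using covered_byD[OF c] above_m by simp
    then have "t = snd q" using covered_byD(4)[OF c, of t] mem m_less_t * by (auto simp: less_imp_le)
    with * show ?thesis by (metis prod.collapse)
  next
    assume *: "snd q = m"
    then have "fst q \<le> b" using covered_byD[OF c] below_m by simp
    then have "fst q = b" using covered_byD(4)[OF c, of b] mem b_less_m * by (auto simp: less_imp_le)
    with * show ?thesis by (metis prod.collapse)
  qed
qed

section \<open>Steps and paths of \<open>N\<close> remain such in \<open>M\<close>\<close>

lemma generated_sublattice_N:
  assumes "X \<subseteq> N"
  shows "generated_sublattice N X = generated_sublattice M X"
proof
  have NM: "sublattice S N \<Longrightarrow> sublattice S M" for S unfolding sublattice_def by blast
  then show "generated_sublattice M X \<subseteq> generated_sublattice N X"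
    unfolding generated_sublattice_def by blast
  show "generated_sublattice N X \<subseteq> generated_sublattice M X"
    unfolding generated_sublattice_def
  proof (rule Inter_greatest)
    fix S assume S: "S \<in> {S. sublattice S M \<and> X \<subseteq> S}"
    \<comment> \<open>\<open>S\<close> can be trimmed to \<open>N\<close> only if something is left,
      as sublattices are nonempty. Otherwise \<open>X\<close> is empty, and the disjoint sublattices
      \<open>{b}\<close> and \<open>{t}\<close> make the intersection empty.\<close>
    show "\<Inter>{S. sublattice S N \<and> X \<subseteq> S} \<subseteq> S"
    proof (cases "S \<inter> N = {}")
      case True
      then have "X = {}" using S assms by blast
      moreover have "sublattice {b} N" "sublattice {t} N" using bt_N by (auto simp: sublattice_def)
      ultimately have "\<Inter>{S. sublattice S N \<and> X \<subseteq> S} \<subseteq> {b} \<inter> {t}" by blast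
      then show ?thesis using bt_N(3) by auto
    next
      case False
      then have "sublattice (S \<inter> N) N"
        using S N_closed unfolding sublattice_def by blast
      then show ?thesis using S assms by blast
    qed
  qed
qed

lemma swings_N:
  assumes "swings N p q"
  shows "swings M p q"
proof -
  obtain c S where c: "covered_by N c (snd p)" "c \<noteq> fst p" "c \<noteq> fst q"
      "S = generated_sublattice N {fst p, fst q, c}" "lattice_isomorphic S (UNIV :: s7 set)"
      "\<forall>d. dual_atom S d \<and> proper_join S d \<longleftrightarrow> d = fst q"
    and p: "prime_interval N p" "prime_interval N q" "p \<noteq> q" "snd p = snd q"
    using assms unfolding swings_def by blast
  have "covered_by M c (snd p)" using c(1) covered_by_N_iff covered_byD(1,2) by blast
  moreover have "S = generated_sublattice M {fst p, fst q, c}"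
    using c(4) generated_sublattice_N covered_byD(1)[OF c(1)] prime_intervalD(1)[OF p(1)]
      prime_intervalD(1)[OF p(2)] by simp
  ultimately show ?thesis
    unfolding swings_def using c p prime_interval_N by blast
qed

lemma sps_projective_N:
  assumes "sps_projective N p q"
  shows "sps_projective M p q"
proof -
  have "sps_step N r s \<Longrightarrow> sps_step M r s" for r s
    unfolding sps_step_def using prime_interval_N swings_N by blast
  then have "(sps_step N)\<^sup>*\<^sup>* r s \<Longrightarrow> (sps_step M)\<^sup>*\<^sup>* r s" for r s
    by (metis (mono_tags) mono_rtranclp)
  then show ?thesis
    using assms prime_interval_N unfolding sps_projective_def by blast
qed

lemma switches_N:
  assumes "switches N p q"
  shows "switches M p q"
proof -
  have "covered_by M v w" if "covered_by N v w" for v w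
    using that covered_by_N_iff covered_byD(1,2)[OF that] by blast
  then have "covering_M3 M S" if "covering_M3 N S" for S
    using that unfolding covering_M3_def sublattice_def by auto
  then show ?thesis
    using assms prime_interval_N unfolding switches_def by blast
qed

lemma swing_path_N: "swing_path N p q \<Longrightarrow> swing_path M p q"
  by (induction rule: swing_path.induct)
    (auto intro: swing_path.intros prime_interval_N sps_projective_N switches_N)

section \<open>Switches inside the diamond\<close>

definition diamond_primes :: "'a \<Rightarrow> 'a \<Rightarrow> ('a \<times> 'a) set" where
  "diamond_primes x y = {(b, x), (b, y), (b, m), (x, t), (y, t), (m, t)}"

text \<open>Two old atoms \<open>x\<close>, \<open>y\<close> and the tab \<open>m\<close> span a
  covering M3 whose six prime intervals are those in \<open>diamond_primes x y\<close>, so one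
  switch connects any two of them.\<close>

lemma diamond_switches:
  assumes xy: "x \<in> atoms" "y \<in> atoms" "x \<noteq> y" and pq: "p \<in> diamond_primes x y" "q \<in> diamond_primes x y" "p \<noteq> q"
  shows "switches M p q"
proof -
  let ?S = "{b, x, y, m, t}"
  have ne: "x \<noteq> m" "y \<noteq> m" using atomsD xy by auto
  have le: "b < x" "x < t" "b < y" "y < t" using atomsD xy by auto
  note si = atom_sup_inf[of x y] atom_sup_inf[of x m] atom_sup_inf[of y m]
  have si: "sup x y = t" "sup x m = t" "sup y m = t" "inf x y = b" "inf x m = b" "inf y m = b"
    using si xy ne by auto
  have "sublattice ?S M"
    unfolding sublattice_def using mem xy atomsD le b_less_m m_less_t si bt_N(3)
    by (auto simp: sup_absorb1 sup_absorb2 inf_absorb1 inf_absorb2 less_imp_le sup_commute inf_commute)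
  moreover have "lattice_isomorphic ?S (Mn 3)"
    using lattice_isomorphic_M3[of b x y m t] le b_less_m m_less_t xy(3) ne si by auto
  moreover have "covered_by M v w" if "covered_by ?S v w" for v w
  proof -
    note d = covered_byD[OF that]
    \<comment> \<open>Otherwise \<open>v\<close> and \<open>w\<close> are both atoms of the diamond,
      which are pairwise incomparable.\<close>
    have "v = b \<or> w = t"
    proof (rule ccontr)
      assume "\<not> (v = b \<or> w = t)"
      then have vw: "v \<in> {x, y, m, t}" "w \<in> {b, x, y, m}" using d(1,2) by auto
      moreover have "v \<noteq> t" using d(3) vw(2) le m_less_t bt_N(3) by (auto dest: less_trans)
      moreover have "w \<noteq> b" using d(3) vw(1) le b_less_m bt_N(3) by (auto dest: less_trans)
      ultimately have vw: "v \<in> insert m atoms" "w \<in> insert m atoms" using xy by auto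
      then have "covered_by M b w" "b < v" "v \<in> M" using atom_covers(1) insert_atomsD by auto
      then show False using d(3) unfolding covered_by_def by blast
    qed
    moreover have "\<not> (v = b \<and> w = t)"
      using d(4)[of x] le by (auto simp: less_imp_le)
    ultimately have "(v, w) \<in> diamond_primes x y"
      using d(1-3) le b_less_m m_less_t by (auto simp: diamond_primes_def)
    then show ?thesis
      using atom_covers xy by (auto simp: diamond_primes_def)
  qed
  ultimately have "covering_M3 M ?S" unfolding covering_M3_def by blast
  moreover have "r \<in> diamond_primes x y \<Longrightarrow> prime_interval M r \<and> fst r \<in> ?S \<and> snd r \<in> ?S" for r
    using atom_covers xy by (auto simp: diamond_primes_def prime_interval_def)
  ultimately show ?thesis
    using pq unfolding switches_def by (intro conjI exI[of _ ?S] insert_subsetI empty_subsetI) auto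
qed

section \<open>Extending congruences from \<open>N\<close> to \<open>M\<close>\<close>

text \<open>The retraction \<open>h\<close> sends the tab to \<open>b\<close>. Its only failures to
  be a homomorphism have \<open>t\<close> in place of \<open>b\<close> under a join, and
  \<open>\<gamma>\<close> identifies the two results; this is enough for the preimage of
  \<open>\<gamma>\<close> to be a congruence.\<close>

lemma extend_congruence_collapsing:
  assumes \<gamma>: "lattice_congruence N \<gamma>" "(b, t) \<in> \<gamma>"
  defines "h \<equiv> \<lambda>v. if v = m then b else v"
  shows "lattice_congruence M {(v, w). v \<in> M \<and> w \<in> M \<and> (h v, h w) \<in> \<gamma>}"
proof -
  note D = lattice_congruenceD[OF \<gamma>(1)]
  have h: "h v \<in> N" if "v \<in> M" for v using that bt_N by (simp add: h_def)
  have hN: "v \<in> N \<Longrightarrow> h v = v" for v by (simp add: h_def)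
  have hm: "h m = b" by (simp add: h_def)
  have m_case: "(h (sup v m), sup (h v) b) \<in> \<gamma> \<and> (h (inf v m), inf (h v) b) \<in> \<gamma>" if "v \<in> N" for v
  proof -
    have 1: "h (sup v m) = (if v \<le> b then b else sup v t)" "h (inf v m) = (if t \<le> v then b else inf v b)"
      using sup_m[OF that] inf_m[OF that] hN N_closed[OF that] bt_N hm by auto
    moreover have "(sup v t, sup v b) \<in> \<gamma>" using D(8)[OF D(4)[OF \<gamma>(2)]] that by simp
    moreover have "inf v b = b" if "t \<le> v" using that bt_N(3) by (simp add: inf_absorb2)
    ultimately show ?thesis
      using D(3) bt_N N_closed[OF that bt_N(1)] hN[OF that] by (auto simp: sup_absorb2)
  qed
  have hom: "(h (sup v w), sup (h v) (h w)) \<in> \<gamma> \<and> (h (inf v w), inf (h v) (h w)) \<in> \<gamma>"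
    if vw: "v \<in> M" "w \<in> M" for v w
  proof (cases "v = m"; cases "w = m")
    assume "v = m" "w = m"
    then show ?thesis using D(3) bt_N hm by simp
  next
    assume "v = m" "w \<noteq> m"
    then show ?thesis using m_case[of w] hm vw by (simp add: sup_commute inf_commute)
  next
    assume "v \<noteq> m" "w = m"
    then show ?thesis using m_case[of v] hm vw by simp
  next
    assume "v \<noteq> m" "w \<noteq> m"
    then show ?thesis using hN D(3) N_closed vw by auto
  qed
  show ?thesis
  proof (rule lattice_congruenceI)
    fix v w z assume vw: "(v, w) \<in> {(v, w). v \<in> M \<and> w \<in> M \<and> (h v, h w) \<in> \<gamma>}" and z: "z \<in> M"
    then have "(sup (h v) (h z), sup (h w) (h z)) \<in> \<gamma>" "(inf (h v) (h z), inf (h w) (h z)) \<in> \<gamma>"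
      using D(6,7) h by auto
    then have "(h (sup v z), h (sup w z)) \<in> \<gamma>" "(h (inf v z), h (inf w z)) \<in> \<gamma>"
      using hom vw z D(4) D(5) by (metis (no_types, lifting) case_prodD mem_Collect_eq)+
    then show "(sup v z, sup w z) \<in> {(v, w). v \<in> M \<and> w \<in> M \<and> (h v, h w) \<in> \<gamma>}"
      "(inf v z, inf w z) \<in> {(v, w). v \<in> M \<and> w \<in> M \<and> (h v, h w) \<in> \<gamma>}"
      using vw z sublatticeD[OF sub] by auto
  next
    show "(v, v) \<in> {(v, w). v \<in> M \<and> w \<in> M \<and> (h v, h w) \<in> \<gamma>}" if "v \<in> M" for v
      using that D(3)[OF h[OF that]] by simp
    show "(w, v) \<in> {(v, w). v \<in> M \<and> w \<in> M \<and> (h v, h w) \<in> \<gamma>}"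
      if "(v, w) \<in> {(v, w). v \<in> M \<and> w \<in> M \<and> (h v, h w) \<in> \<gamma>}" for v w
      using that D(4) by blast
    show "(v, z) \<in> {(v, w). v \<in> M \<and> w \<in> M \<and> (h v, h w) \<in> \<gamma>}"
      if "(v, w) \<in> {(v, w). v \<in> M \<and> w \<in> M \<and> (h v, h w) \<in> \<gamma>}"
        "(w, z) \<in> {(v, w). v \<in> M \<and> w \<in> M \<and> (h v, h w) \<in> \<gamma>}" for v w z
      using that D(5)[of "h v" "h w" "h z"] by simp
  qed auto
qed

text \<open>By \<open>sup_m\<close> and \<open>inf_m\<close>, operations with \<open>m\<close>
  branch on \<open>v \<le> b\<close> and on \<open>t \<le> v\<close>. The extension is compatible
  once \<open>\<alpha>\<close> respects both branches, which is what \<open>below\<close> and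
  \<open>above\<close> extract from the hypotheses.\<close>

lemma extend_congruence_singleton:
  assumes \<alpha>: "lattice_congruence N \<alpha>"
    and no_atom: "\<And>z. z \<in> atoms \<Longrightarrow> (b, z) \<notin> \<alpha>"
    and no_comp: "\<And>z. z \<in> N \<Longrightarrow> z < t \<Longrightarrow> sup z b = t \<Longrightarrow> (z, t) \<notin> \<alpha>"
  shows "lattice_congruence M (insert (m, m) \<alpha>)"
proof -
  note D = lattice_congruenceD[OF \<alpha>]
  obtain x where x: "x \<in> atoms" using obtain_other_atom by blast
  \<comment> \<open>If \<open>v\<close> escapes, \<open>b\<close> is collapsed with
    \<open>sup v b\<close>. The part of \<open>sup v b\<close> below \<open>t\<close> exceeds
    \<open>b\<close>, so some atom is collapsed with \<open>b\<close>.\<close>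
  have below: "v \<le> b" if uv: "(u, v) \<in> \<alpha>" "u \<le> b" for u v
  proof (rule ccontr)
    assume nle: "\<not> v \<le> b"
    let ?v = "sup v b"
    have v: "v \<in> N" using D(2) uv by blast
    then have v': "?v \<in> N" using N_closed bt_N by blast
    have bv: "(b, ?v) \<in> \<alpha>" using D(6)[OF uv(1) bt_N(1)] uv(2) by (simp add: sup_absorb2)
    have "b < ?v" using nle by (metis le_iff_sup less_le sup.commute sup_ge2)
    then obtain c where c: "covered_by M b c" "c \<le> ?v"
      using finite_upper_cover[OF fin] mem v' by blast
    have w: "inf ?v t \<noteq> b"
    proof
      assume *: "inf ?v t = b"
      \<comment> \<open>Semimodularity, applied to the cover \<open>c\<close> of \<open>b\<close>
        and to \<open>m\<close>, keeps \<open>c\<close> below \<open>t\<close>: the join of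
        \<open>c\<close> and \<open>m\<close> is \<open>m\<close> or covers \<open>m\<close>, and
        the only upper cover of \<open>m\<close> is \<open>t\<close>.\<close>
      have "sup b m = sup c m \<or> covered_by M (sup b m) (sup c m)"
        using smod c(1) mem covered_byD(2)[OF c(1)] unfolding semimodular_def by blast
      then have "c \<le> t"
      proof
        assume "sup b m = sup c m"
        then show ?thesis using b_less_m m_less_t by (metis le_iff_sup less_imp_le order_trans sup_ge1)
      next
        assume "covered_by M (sup b m) (sup c m)"
        then have cov: "covered_by M m (sup c m)" using b_less_m by (simp add: sup_absorb2 less_imp_le)
        then have "t \<le> sup c m" using above_m covered_byD[OF cov] by blast
        then have "t = sup c m" using covered_byD(4)[OF cov, of t] mem m_less_t by (auto simp: less_imp_le)
        then show ?thesis by simp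
      qed
      then have "c \<le> b" using c(2) * by (metis le_inf_iff)
      then show False using covered_byD(3)[OF c(1)] by auto
    qed
    have bw: "(b, inf ?v t) \<in> \<alpha>" using D(7)[OF bv bt_N(2)] bt_N by (simp add: inf_absorb1 less_imp_le)
    have "b \<le> inf ?v t" using bt_N by (simp add: less_imp_le)
    show False
    proof (cases "inf ?v t = t")
      case True
      then have "(b, x) \<in> \<alpha>" using D(7)[OF bw, of x] atomsD[OF x] by (simp add: inf_absorb1 inf_absorb2 less_imp_le)
      then show False using no_atom x by blast
    next
      case False
      then have "inf ?v t \<in> atoms"
        using N_closed(2)[OF v' bt_N(2)] w \<open>b \<le> inf ?v t\<close> unfolding atoms_def by (auto simp: less_le)
      then show False using no_atom bw by blast
    qed
  qed
  \<comment> \<open>Meeting with an atom \<open>w\<close> other than \<open>s\<close> turns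
    \<open>(t, s)\<close> into \<open>(w, b)\<close>, which \<open>no_atom\<close> forbids.\<close>
  have inside: False if s: "s \<in> N" "b \<le> s" "s < t" "(t, s) \<in> \<alpha>" for s
  proof -
    obtain w where w: "w \<in> atoms" "w \<noteq> s" using obtain_other_atom by blast
    have "inf s w = b"
    proof (cases "s = b")
      case True
      then show ?thesis using atomsD[OF w(1)] by (simp add: inf_absorb1 less_imp_le)
    next
      case False
      then have "s \<in> atoms" using s unfolding atoms_def by auto
      then show ?thesis using atom_sup_inf[of s w] w by simp
    qed
    then have "(w, b) \<in> \<alpha>" using D(7)[OF s(4), of w] atomsD[OF w(1)] by (simp add: inf_absorb2 less_imp_le)
    then show False using no_atom w(1) D(4) by blast
  qed
  \<comment> \<open>Here \<open>?z\<close> is collapsed with \<open>t\<close>; joining with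
    \<open>b\<close> lands either at \<open>t\<close>, against \<open>no_comp\<close>, or strictly
    below \<open>t\<close> in the diamond, against \<open>inside\<close>.\<close>
  have above: "t \<le> v" if uv: "(u, v) \<in> \<alpha>" "t \<le> u" for u v
  proof (rule ccontr)
    assume nle: "\<not> t \<le> v"
    let ?z = "inf v t"
    have v: "v \<in> N" using D(2) uv by blast
    then have z: "?z \<in> N" using N_closed bt_N by blast
    have tz: "(t, ?z) \<in> \<alpha>" using D(7)[OF uv(1) bt_N(2)] uv(2) by (simp add: inf_absorb2)
    have zt: "?z < t" using nle by (metis inf_le1 inf_le2 less_le)
    have ts: "(t, sup ?z b) \<in> \<alpha>" using D(6)[OF tz bt_N(1)] bt_N by (simp add: sup_absorb1 less_imp_le)
    have "sup ?z b \<le> t" using bt_N(3) by (simp add: less_imp_le)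
    then show False
      using inside[OF N_closed(1)[OF z bt_N(1)] sup_ge2 _ ts] no_comp[OF z zt] D(4)[OF tz]
      by (auto simp: le_less)
  qed
  have sup_case: "(sup u z, sup v z) \<in> insert (m, m) \<alpha>" if uv: "(u, v) \<in> \<alpha>" "z \<in> M" for u v z
  proof (cases "z = m")
    case True
    have "u \<le> b \<longleftrightarrow> v \<le> b" using below uv D(4) by blast
    then show ?thesis using True sup_m D(1,2)[OF uv(1)] D(6)[OF uv(1) bt_N(2)] by simp
  next
    case False
    then show ?thesis using D(6) uv by simp
  qed
  have inf_case: "(inf u z, inf v z) \<in> insert (m, m) \<alpha>" if uv: "(u, v) \<in> \<alpha>" "z \<in> M" for u v z
  proof (cases "z = m")
    case True
    have "t \<le> u \<longleftrightarrow> t \<le> v" using above uv D(4) by blast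
    then show ?thesis using True inf_m D(1,2)[OF uv(1)] D(7)[OF uv(1) bt_N(1)] by simp
  next
    case False
    then show ?thesis using D(7) uv by simp
  qed
  have m_case: "(sup m z, sup m z) \<in> insert (m, m) \<alpha>" "(inf m z, inf m z) \<in> insert (m, m) \<alpha>" if "z \<in> M" for z
    using D(3) sublatticeD(1,2)[OF sub mem(1) that] by auto
  show ?thesis
  proof (rule lattice_congruenceI)
    show "insert (m, m) \<alpha> \<subseteq> M \<times> M" using D(1,2) mem by auto
    show "(v, v) \<in> insert (m, m) \<alpha>" if "v \<in> M" for v using D(3) that by auto
    show "(w, v) \<in> insert (m, m) \<alpha>" if "(v, w) \<in> insert (m, m) \<alpha>" for v w using D(4) that by auto
    show "(v, z) \<in> insert (m, m) \<alpha>" if "(v, w) \<in> insert (m, m) \<alpha>" "(w, z) \<in> insert (m, m) \<alpha>" for v w z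
      using that D(1,2) D(5) by blast
    show "(sup v z, sup w z) \<in> insert (m, m) \<alpha>" if "(v, w) \<in> insert (m, m) \<alpha>" "z \<in> M" for v w z
      using that sup_case m_case by blast
    show "(inf v z, inf w z) \<in> insert (m, m) \<alpha>" if "(v, w) \<in> insert (m, m) \<alpha>" "z \<in> M" for v w z
      using that inf_case m_case by blast
  qed
qed

text \<open>The \<open>S7\<close> has dual atoms \<open>z\<close>, \<open>x\<close>,
  \<open>m\<close>, bottom \<open>inf z b\<close>, and \<open>inf z x\<close> and \<open>b\<close>
  in the places of \<open>S7_y\<close> and \<open>S7_o\<close>. The tab supplies the third dual
  atom, and \<open>x\<close> is the proper join, namely of \<open>inf z x\<close> and
  \<open>b\<close>.\<close>

lemma swing_into_diamond:
  assumes z: "z \<in> N" "covered_by M z t" "sup z b = t" and x: "x \<in> atoms" "\<not> inf z x \<le> b"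
  shows "swings M (z, t) (x, t)"
proof -
  let ?y = "inf z x" and ?u = "inf z b"
  have zt: "z < t" "\<not> t \<le> z" using covered_byD(3)[OF z(2)] by auto
  have bx: "b < x" "x < t" "x \<noteq> m" "x \<in> M" using atomsD x by auto
  have bz: "\<not> b \<le> z" using z(3) zt by (auto simp: sup_absorb1)
  have yM: "?y \<in> M" using sublatticeD(2)[OF sub] z bx by auto
  have inf_zm: "inf z m = ?u" using inf_m[OF z(1)] zt by simp
  \<comment> \<open>As \<open>x\<close> covers \<open>b\<close>, joining \<open>b\<close> with
    \<open>?y\<close> can only give \<open>b\<close> or \<open>x\<close>, and \<open>?y\<close> is
    not below \<open>b\<close>.\<close>
  have "sup ?y b = b \<or> sup ?y b = x"
    using yM mem sublatticeD(1)[OF sub] bx atom_covers(1)[of x] x(1)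
    by (intro covered_byD(4)[of M b x]) auto
  then have yb: "sup ?y b = x" using x(2) by (metis sup_ge1)
  have xm: "sup x m = t" "inf x m = b" using atom_sup_inf[of x m] x(1) bx by auto
  have ux: "?u \<le> x" using bx by (meson inf_le2 less_imp_le order_trans)
  have ym: "sup ?y m = t"
    using yb xm(1) b_less_m by (metis le_iff_sup less_imp_le sup_assoc)
  have xb: "inf x b = b" using bx by (simp add: inf_absorb2 less_imp_le)
  have iyb: "inf ?y b = ?u" using xb by (simp add: inf_assoc)
  have iym: "inf ?y m = ?u" using xm(2) by (simp add: inf_assoc)
  have zb: "\<not> z \<le> b"
    using z(3) bt_N(3) by (auto simp: sup_absorb2)
  have zx: "\<not> z \<le> x"
  proof
    assume "z \<le> x"
    then have "sup z b \<le> x" using bx by simp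
    then show False using z(3) bx by auto
  qed
  have dist: "distinct [?u, ?y, b, z, x, m, t]"
  proof -
    have "?u < b" using bz by (metis inf_le1 inf_le2 less_le)
    moreover have "?u \<noteq> z" using zb by (metis inf_le2)
    moreover have "?y < z" using zx by (metis inf_le1 inf_le2 less_le)
    moreover have "?u \<noteq> ?y" using x(2) by (metis inf_le2)
    moreover have "?y \<noteq> m" using b_less_m iym bz by (metis inf.idem inf_le1 less_imp_le order_trans)
    moreover have "?y \<noteq> x" using bz bx by (metis inf_le1 less_imp_le order_trans)
    moreover have "?y \<noteq> b" using x(2) by auto
    moreover have "?u \<le> z" "?y \<le> z" by auto
    moreover have "z \<noteq> b" "z \<noteq> x" "z \<noteq> m" using bz zx z by auto
    ultimately show ?thesis using zt bx b_less_m m_less_t by auto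
  qed
  have cov: "covered_by M x t" "covered_by M m t" using atom_covers(2) x(1) by auto
  have "sup b z = t" "inf b z = ?u" using z(3) by (simp_all add: sup_commute inf_commute)
  then show ?thesis
    using swings_S7[OF sub z(2) cov dist yb ym _ iyb iym _ _ inf_zm xm(2)] by simp
qed

section \<open>Lifting paths from \<open>N\<close> to \<open>M\<close>\<close>

context
  assumes paths_N: "\<And>p q. prime_interval N p \<Longrightarrow> prime_interval N q \<Longrightarrow> q \<in> con N p \<Longrightarrow> swing_path N p q"
begin

text \<open>The join \<open>?\<gamma>\<close> collapses \<open>(b, t)\<close>, hence extends to
  \<open>M\<close>, and its extension bounds \<open>con M p\<close>. So \<open>q\<close> is
  collapsed in \<open>N\<close> by \<open>p\<close>, by \<open>(b, x)\<close> or by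
  \<open>(b, y)\<close>; the last two are reached from \<open>d\<close> by switches.\<close>

lemma path_through_diamond:
  assumes p: "prime_interval N p" and q: "prime_interval N q" "q \<in> con M p"
    and xy: "x \<in> atoms" "y \<in> atoms" "x \<noteq> y" and d: "d \<in> diamond_primes x y" "swing_path M p d"
  shows "swing_path M p q"
proof -
  let ?\<Theta> = "{con N p, con N (b, x), con N (b, y)}"
  let ?\<gamma> = "(\<Union>?\<Theta>)\<^sup>+"
  define h where "h = (\<lambda>v. if v = m then b else v)"
  note px = atom_primes_N(1)[OF xy(1)] and py = atom_primes_N(1)[OF xy(2)]
  have cong: "lattice_congruence N \<theta>" if "\<theta> \<in> ?\<Theta>" for \<theta>
    using that prime_con(1)[OF sub_N p] prime_con(1)[OF sub_N px] prime_con(1)[OF sub_N py] by blast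
  then have \<gamma>: "lattice_congruence N ?\<gamma>"
    by (intro lattice_congruence_trancl_Union) auto
  \<comment> \<open>Joining \<open>(b, y)\<close> with \<open>x\<close> yields
    \<open>(x, t)\<close>, which together with \<open>(b, x)\<close> links \<open>b\<close> to
    \<open>t\<close>; this is why two atoms enter the join.\<close>
  have "(sup b x, sup y x) \<in> con N (b, y)"
    using lattice_congruenceD(6)[OF prime_con[OF sub_N py]] atomsD(1) xy by blast
  then have "(x, t) \<in> con N (b, y)"
    using atom_sup_inf[of y x] xy atomsD(3)[OF xy(1)] by (simp add: sup_absorb2 less_imp_le)
  then have "(b, t) \<in> ?\<gamma>"
    using prime_con(2)[OF sub_N px] by (meson UnionI insertI1 insertI2 r_into_trancl trancl_into_trancl)
  from extend_congruence_collapsing[OF \<gamma> this]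
  have ext: "lattice_congruence M {(v, w). v \<in> M \<and> w \<in> M \<and> (h v, h w) \<in> ?\<gamma>}"
    unfolding h_def .
  have "p \<in> {(v, w). v \<in> M \<and> w \<in> M \<and> (h v, h w) \<in> ?\<gamma>}"
    using prime_intervalD[OF p] prime_con(2)[OF sub_N p] by (cases p) (auto simp: h_def)
  then have "con M p \<subseteq> {(v, w). v \<in> M \<and> w \<in> M \<and> (h v, h w) \<in> ?\<gamma>}"
    by (rule con_least[OF ext])
  then have "(fst q, snd q) \<in> ?\<gamma>"
    using q(2) prime_intervalD[OF q(1)] by (cases q) (auto simp: h_def)
  then have "(fst q, snd q) \<in> \<Union>?\<Theta>"
    using q(1) unfolding prime_interval_def by (intro covered_by_in_trancl_Union[OF sub_N cong])
  then have "q \<in> \<Union>?\<Theta>" by simp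
  then consider "q \<in> con N p" | e where "e \<in> {(b, x), (b, y)}" "q \<in> con N e" by auto
  then show ?thesis
  proof cases
    case 1
    then show ?thesis using paths_N p q(1) swing_path_N by blast
  next
    case 2
    have e: "e \<in> diamond_primes x y" "e \<noteq> (m, t)" "prime_interval N e"
      using 2(1) px py b_less_m by (auto simp: diamond_primes_def)
    then have eq: "swing_path M e q" using paths_N 2(2) q(1) swing_path_N by blast
    \<comment> \<open>Paths compose only through a switch, and an interval does not switch to
      itself. When \<open>d\<close> is already \<open>e\<close>, a detour through
      \<open>(m, t)\<close> provides the switch.\<close>
    obtain e' where e': "swing_path M p e'" "switches M e' e"
    proof (cases "d = e")
      case True
      have mt: "(m, t) \<in> diamond_primes x y" by (simp add: diamond_primes_def)
      have "swing_path M p (m, t)"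
        using swing_path_switch[OF d(2) diamond_switches[OF xy d(1) mt]] True e(2) by blast
      then show thesis using that diamond_switches[OF xy mt e(1)] e(2) by metis
    next
      case False
      then show thesis using that d diamond_switches[OF xy d(1) e(1)] by blast
    qed
    then show ?thesis using swing_path_trans eq by blast
  qed
qed

lemma path_between_old_primes:
  assumes p: "prime_interval N p" and q: "prime_interval N q" "q \<in> con M p"
  shows "swing_path M p q"
proof -
  note \<alpha> = prime_con[OF sub_N p]
  note D = lattice_congruenceD[OF \<alpha>(1)]
  \<comment> \<open>The first two cases are the ways in which the hypotheses of
    \<open>extend_congruence_singleton\<close> can fail.\<close>
  consider z where "z \<in> atoms" "(b, z) \<in> con N p"
    | z where "\<And>z. z \<in> atoms \<Longrightarrow> (b, z) \<notin> con N p" "z \<in> N" "z < t" "sup z b = t" "(z, t) \<in> con N p"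
    | "\<And>z. z \<in> atoms \<Longrightarrow> (b, z) \<notin> con N p"
      "\<And>z. z \<in> N \<Longrightarrow> z < t \<Longrightarrow> sup z b = t \<Longrightarrow> (z, t) \<notin> con N p"
    by blast
  then show ?thesis
  proof cases
    case (1 z)
    obtain y where y: "y \<in> atoms" "y \<noteq> z" using obtain_other_atom by blast
    have "swing_path M p (b, z)"
      using paths_N[OF p atom_primes_N(1)[OF 1(1)] 1(2)] swing_path_N by blast
    then show ?thesis
      by (rule path_through_diamond[OF p q 1(1) y(1), rotated 2]) (use y(2) in \<open>auto simp: diamond_primes_def\<close>)
  next
    case (2 z)
    obtain x where x: "x \<in> atoms" using obtain_other_atom by blast
    obtain y where y: "y \<in> atoms" "y \<noteq> x" using obtain_other_atom by blast
    \<comment> \<open>A swing starts at a prime interval, so \<open>z\<close> is raised to a lower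
      cover \<open>c\<close> of \<open>t\<close>; the collapse with \<open>t\<close> and the join
      \<open>t\<close> with \<open>b\<close> both survive.\<close>
    have "finite N" using fin by simp
    then obtain c where c: "covered_by N c t" "z \<le> c"
      using finite_lower_cover[of N z t] 2 bt_N by blast
    note cd = covered_byD[OF c(1)]
    have ct: "(c, t) \<in> con N p"
      using D(6)[OF 2(5) cd(1)] c(2) cd(3) by (simp add: sup_absorb1 sup_absorb2 less_imp_le)
    have cb: "sup c b = t"
    proof (rule antisym)
      show "sup c b \<le> t" using cd(3) bt_N(3) by (simp add: less_imp_le)
      show "t \<le> sup c b" using c(2) 2(4) by (metis sup.mono order_refl)
    qed
    \<comment> \<open>Otherwise meeting \<open>(c, t)\<close> with \<open>x\<close> and joining with
      \<open>b\<close> would collapse \<open>(b, x)\<close>, which this case excludes.\<close>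
    have "\<not> inf c x \<le> b"
    proof
      assume le: "inf c x \<le> b"
      have "(inf c x, x) \<in> con N p"
        using D(7)[OF ct atomsD(1)[OF x]] atomsD(4)[OF x] by (simp add: inf_absorb2 less_imp_le)
      then have "(b, x) \<in> con N p"
        using D(6)[of "inf c x" x b] bt_N(1) le atomsD(3)[OF x] by (simp add: sup_absorb1 sup_absorb2 less_imp_le)
      then show False using 2(1) x by blast
    qed
    then have "swings M (c, t) (x, t)"
      using swing_into_diamond[OF cd(1) _ cb x] c(1) covered_by_N_iff[OF cd(1) bt_N(2)] by blast
    moreover have "swing_path M p (c, t)"
      using paths_N[OF p _ ct] c(1) swing_path_N by (simp add: prime_interval_def)
    ultimately have "swing_path M p (x, t)"
      using swing_path_sps_step by (metis sps_step_def swings_def)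
    then show ?thesis
      by (rule path_through_diamond[OF p q x y(1), rotated 2]) (use y(2) in \<open>auto simp: diamond_primes_def\<close>)
  next
    case 3
    have "con M p \<subseteq> insert (m, m) (con N p)"
      using extend_congruence_singleton[OF \<alpha>(1) 3] \<alpha>(2) con_least by blast
    then have "q \<in> con N p" using q(2) prime_intervalD(3)[OF q(1)] by auto
    then show ?thesis using paths_N p q(1) swing_path_N by blast
  qed
qed

text \<open>A prime interval with endpoint \<open>m\<close> is exchanged for \<open>(x, t)\<close>:
  the switch to it preserves collapse, and the reverse switch ends the path.\<close>

lemma path_from_old_prime:
  assumes p: "prime_interval N p" and q: "prime_interval M q" "q \<in> con M p"
  shows "swing_path M p q"
proof (cases "prime_interval N q")
  case True
  then show ?thesis using path_between_old_primes p q by blast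
next
  case False
  obtain x where x: "x \<in> atoms" using obtain_other_atom by blast
  obtain y where y: "y \<in> atoms" "x \<noteq> y" using obtain_other_atom by metis
  have q': "q \<in> diamond_primes x y" "q \<noteq> (x, t)"
    using new_primes[OF q(1) False] atomsD[OF x] by (auto simp: diamond_primes_def)
  have xt: "(x, t) \<in> diamond_primes x y" by (simp add: diamond_primes_def)
  have "switches M q (x, t)" using diamond_switches[OF x y q'(1) xt q'(2)] .
  then have "(x, t) \<in> con M p"
    using switches_congruence[OF sub prime_con(1)[OF sub prime_interval_N[OF p]]] q(2) by blast
  then have "swing_path M p (x, t)"
    using path_between_old_primes[OF p atom_primes_N(2)[OF x]] by blast
  moreover have "switches M (x, t) q" using diamond_switches[OF x y xt q'(1)] q'(2) by metis
  ultimately show ?thesis by (rule swing_path_switch)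
qed

text \<open>A start with endpoint \<open>m\<close> first switches to \<open>(b, x)\<close>. The
  switch back shows that \<open>con M (b, x)\<close> collapses everything that
  \<open>con M p\<close> does.\<close>

lemma path_M:
  assumes p: "prime_interval M p" and q: "prime_interval M q" "q \<in> con M p"
  shows "swing_path M p q"
proof (cases "prime_interval N p")
  case True
  then show ?thesis using path_from_old_prime q by blast
next
  case False
  obtain x where x: "x \<in> atoms" using obtain_other_atom by blast
  obtain y where y: "y \<in> atoms" "x \<noteq> y" using obtain_other_atom by metis
  have p': "p \<in> diamond_primes x y" "p \<noteq> (b, x)"
    using new_primes[OF p False] atomsD[OF x] b_less_m by (auto simp: diamond_primes_def)
  have bx: "(b, x) \<in> diamond_primes x y" by (simp add: diamond_primes_def)
  note bx_prime = atom_primes_N(1)[OF x]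
  note con_bx = prime_con[OF sub prime_interval_N[OF bx_prime]]
  have "switches M (b, x) p" using diamond_switches[OF x y bx p'(1)] p'(2) by metis
  then have "p \<in> con M (b, x)" using switches_congruence[OF sub con_bx(1)] con_bx(2) by blast
  then have "q \<in> con M (b, x)" using q(2) con_least[OF con_bx(1)] by blast
  then have "swing_path M (b, x) q" using path_from_old_prime[OF bx_prime q(1)] by blast
  then show ?thesis
    using swing_path_trans[OF swing_path_refl[OF p] diamond_switches[OF x y p'(1) bx p'(2)]] by blast
qed

end

end

section \<open>From tabs to the induction along the strippings\<close>

lemma tab_diamond_if_tab:
  assumes M: "sublattice M UNIV" "finite M" "semimodular M" and tab: "tab M m"
  obtains b t where "tab_diamond M m b t"
proof -
  obtain D b t n f where D: "m \<in> D" "D = interval M b t" "b \<in> M" "t \<in> M" "b \<le> t" "3 \<le> n"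
    and f: "bij_betw f D (Mn n)"
    and hom: "\<And>x y. x \<in> D \<Longrightarrow> y \<in> D \<Longrightarrow> f (sup x y) = sup (f x) (f y) \<and> f (inf x y) = inf (f x) (f y)"
    using tab unfolding tab_def covering_multi_diamond_def lattice_isomorphic_def by blast
  have di: "m \<in> M" "\<exists>!x. covered_by M x m" "\<exists>!y. covered_by M m y"
    using tab unfolding tab_def doubly_irreducible_def by auto
  have D_iff: "z \<in> D \<longleftrightarrow> z \<in> M \<and> b \<le> z \<and> z \<le> t" for z
    using D(2) by (auto simp: interval_def)
  have bt: "b \<in> D" "t \<in> D" using D_iff D by auto
  have inj: "f x = f y \<longleftrightarrow> x = y" if "x \<in> D" "y \<in> D" for x y
    using f that by (auto simp: bij_betw_def inj_on_eq_iff)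
  have sup_D: "sup x y \<in> D" "inf x y \<in> D" if "x \<in> D" "y \<in> D" for x y
    using that D_iff sublatticeD[OF M(1)] by (auto intro: le_supI1 le_infI1)
  have f_le: "f x \<le> f y \<longleftrightarrow> x \<le> y" if "x \<in> D" "y \<in> D" for x y
    using hom[OF that] inj[OF sup_D(1)[OF that] that(2)] by (metis le_iff_sup)
  have f_mem: "f x \<in> Mn n" if "x \<in> D" for x using f that by (auto simp: bij_betw_def)
  have onto: "\<exists>x\<in>D. f x = k" if "k \<in> Mn n" for k
    using that unfolding bij_betw_imp_surj_on[OF f, symmetric] by blast
  have fb: "f b = Mn_bot"
  proof -
    obtain x where x: "x \<in> D" "f x = Mn_bot" using onto[of Mn_bot] by (auto simp: Mn_def)
    have "f b \<le> f x" using f_le bt x D_iff by blast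
    then show ?thesis using x by (auto simp: less_eq_mn_def)
  qed
  have ft: "f t = Mn_top"
  proof -
    obtain x where x: "x \<in> D" "f x = Mn_top" using onto[of Mn_top] by (auto simp: Mn_def)
    have "f x \<le> f t" using f_le bt x D_iff by blast
    then show ?thesis using x by (auto simp: less_eq_mn_def)
  qed
  have atom: "\<exists>k. f z = Mn_atom k" if "z \<in> M" "b < z" "z < t" for z
  proof -
    have "z \<in> D" using that D_iff by (simp add: less_imp_le)
    then have "f z \<noteq> Mn_bot" "f z \<noteq> Mn_top" using inj[of z b] inj[of z t] bt fb ft that by auto
    then show ?thesis by (cases "f z") auto
  qed
  have atomI: "z \<in> M \<and> b < z \<and> z < t" if "z \<in> D" "f z = Mn_atom k" for z k
    using that D_iff fb ft by (auto simp: less_le)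
  have diamond: "sup z w = t \<and> inf z w = b"
    if zw: "z \<in> M" "w \<in> M" "b < z" "z < t" "b < w" "w < t" "z \<noteq> w" for z w
  proof -
    obtain k l where kl: "f z = Mn_atom k" "f w = Mn_atom l" using atom zw by metis
    have D': "z \<in> D" "w \<in> D" using zw D_iff by (auto simp: less_imp_le)
    have "k \<noteq> l" using inj[OF D'] zw kl by auto
    then have "f (sup z w) = f t" "f (inf z w) = f b"
      using hom[OF D'] kl fb ft by (auto simp: sup_mn_def inf_mn_def less_eq_mn_def)
    then show ?thesis using inj sup_D[OF D'] bt by auto
  qed
  have covers: "covered_by M b z" "covered_by M z t" if z: "z \<in> M" "b < z" "z < t" for z
  proof -
    have "w = z" if w: "w \<in> M" "b < w" "w < t" "w \<le> z \<or> z \<le> w" for w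
    proof (rule ccontr)
      assume "w \<noteq> z"
      then have "sup w z = t \<and> inf w z = b" using diamond w z by blast
      then show False using w z by (auto simp: sup_absorb1 sup_absorb2 inf_absorb1 inf_absorb2)
    qed
    then have "\<not> (b < w \<and> w < z)" "\<not> (z < w \<and> w < t)" if "w \<in> M" for w
      using that z by (metis less_imp_le less_trans order_less_irrefl)+
    then show "covered_by M b z" "covered_by M z t"
      unfolding covered_by_def using z D(3,4) by blast+
  qed
  have "Mn_atom 0 \<in> Mn n" "Mn_atom 1 \<in> Mn n" "Mn_atom 2 \<in> Mn n" using D(6) by (auto simp: Mn_def)
  then obtain x0 x1 x2 where x: "x0 \<in> D" "f x0 = Mn_atom 0" "x1 \<in> D" "f x1 = Mn_atom 1" "x2 \<in> D" "f x2 = Mn_atom 2"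
    using onto by metis
  have xne: "x0 \<noteq> x1" "x0 \<noteq> x2" "x1 \<noteq> x2" using x by auto
  have xa: "x0 \<in> M \<and> b < x0 \<and> x0 < t" "x1 \<in> M \<and> b < x1 \<and> x1 < t" "x2 \<in> M \<and> b < x2 \<and> x2 < t"
    using atomI x by blast+
  \<comment> \<open>\<open>b\<close> has two upper covers and \<open>t\<close> has two lower covers,
    so a doubly-irreducible element is neither.\<close>
  have "m \<noteq> b" using di(3) covers(1)[of x0] covers(1)[of x1] xa xne by blast
  moreover have "m \<noteq> t" using di(2) covers(2)[of x0] covers(2)[of x1] xa xne by blast
  ultimately have bmt: "b < m" "m < t" using D(1) D_iff by (auto simp: less_le)
  have "tab_diamond M m b t"
  proof
    show "z \<le> b" if z: "z \<in> M" "z < m" for z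
    proof -
      \<comment> \<open>The cover \<open>c\<close> must be \<open>b\<close>, the only lower cover of
        \<open>m\<close>.\<close>
      obtain c where "covered_by M c m" "z \<le> c" using finite_lower_cover[OF M(2) z(1) di(1) z(2)] .
      then show ?thesis using di(2) covers(1)[OF di(1) bmt] by blast
    qed
    show "t \<le> z" if z: "z \<in> M" "m < z" for z
    proof -
      obtain c where "covered_by M m c" "c \<le> z" using finite_upper_cover[OF M(2) di(1) z] .
      then show ?thesis using di(3) covers(2)[OF di(1) bmt] by blast
    qed
    \<comment> \<open>Of three atoms at least two differ from \<open>m\<close>.\<close>
    show "\<exists>x\<in>M - {m}. \<exists>y\<in>M - {m}. x \<noteq> y \<and> b < x \<and> x < t \<and> b < y \<and> y < t"
      using xa xne by (cases "m = x0"; cases "m = x1") blast+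
  qed (use M D di bmt diamond in auto)
  then show thesis by (rule that)
qed

theorem lemma18:
  fixes L K :: "'a::lattice set"
  assumes "sublattice L UNIV"
    and "finite L"
    and "semimodular L"
    and "stripped_sublattice K L"
    and "satisfies_swing_lemma K"
  shows "satisfies_general_swing_lemma L"
proof -
  have "strips_to\<^sup>*\<^sup>* L K" using assms(4) by (simp add: stripped_sublattice_def)
  \<comment> \<open>What is carried along the strippings is the existence of paths, with finiteness
    and semimodularity handed down to each intermediate lattice; the induction runs from
    \<open>K\<close> upwards.\<close>
  then have "\<forall>p q. prime_interval L p \<longrightarrow> prime_interval L q \<longrightarrow> q \<in> con L p \<longrightarrow> swing_path L p q"
    using assms(1-3)
  proof (induction rule: converse_rtranclp_induct)
    case base
    show ?case
    proof (intro allI impI)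
      fix p q assume pq: "prime_interval K p" "prime_interval K q" "q \<in> con K p"
      then have "congruence_spreads K p q"
        unfolding congruence_spreads_def using con_least prime_con[OF base(1)] by blast
      \<comment> \<open>In \<open>K\<close> a single SPS projection already serves as a path without
        switches.\<close>
      then show "swing_path K p q"
        using assms(5) pq swing_path.base unfolding satisfies_swing_lemma_def by blast
    qed
  next
    case (step M N)
    then obtain m where m: "tab M m" and N: "N = M - {m}" by (auto simp: strips_to_def)
    obtain b t where "tab_diamond M m b t" using tab_diamond_if_tab[OF step.prems m] .
    then interpret tab_diamond M m b t .
    \<comment> \<open>The induction hypothesis discharges \<open>paths_N\<close>, as the stripped
      lattice inherits finiteness and semimodularity.\<close>
    have "swing_path (M - {m}) p q"
      if "prime_interval (M - {m}) p" "prime_interval (M - {m}) q" "q \<in> con (M - {m}) p" for p q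
      using step.IH sub_N semimodular_N fin that unfolding N by blast
    then show ?case using path_M by blast
  qed
  then show ?thesis using satisfies_general_swing_lemmaI[OF assms(1)] by blast
qed

end
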